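(* Let $\ell_1\ge1$ and $1\le \ell_2\le k_2$ be integers, let $0<p<1$, $q=1-p$, and put $a(p)=q^{\ell_1}p^{\ell_2}$, $\ell=\ell_1+\ell_2$, $m_2=k_2-\ell_2+1$. Let $\rho_r$ be the waiting time, in a sequence of independent Bernoulli($p$) trials, for the $r$-th occurrence of the pattern "at least $\ell_1$ consecutive 0's followed by at least $\ell_2$ and at most $k_2$ consecutive 1's". Let $H_r(t)=E[t^{\rho_r}]$, $g_r(m)=P(\rho_r=m)$ and $\tilde\mu_{r,j}=E[\rho_r^{\,j}]$. Let $\delta_{i,j}$ be the Kronecker delta and $\mathbf 1(\cdot)$ the indicator. Then: (i) For $r\ge1$ and $|t|\le 1$, $\displaystyle H_r(t)=\frac{qt}{1-pt}\left(\frac{a(p)t^\ell(1-(pt)^{m_2})}{1-t+a(p)t^\ell(1-(pt)^{m_2})}\right)^r.$ (ii) For $r\ge2$ and $m\ge \ell r+1$, $$g_r(m)=g_r(m-1)+a(p)\left[g_{r-1}(m-\ell)-g_r(m-\ell)-p^{m_2}\big(g_{r-1}(m-\ell-m_2)-g_r(m-\ell-m_2)\big)\right],$$ and for $m\ge \ell+1$, $$g_1(m)=g_1(m-1)-a(p)\left[g_1(m-\ell)-p^{m_2}g_1(m-\ell-m_2)\right]+q\,a(p)\,p^{m-\ell-1}\,\mathbf 1(\ell+1\le m\le \ell+m_2),$$ with initial conditions $g_0(m)=\delta_{m,0}$ and $g_r(m)=0$ whenever $m\le \ell r$ and $r\ge1$. (iii) For $j\ge1$ and $r\ge2$, $$\tilde\mu_{r,j}=\sum_{k=0}^{j}\binom{j}{k}\left[\tilde\mu_{r,k}+a(p)\left(\ell^{j-k}-p^{m_2}(\ell+m_2)^{j-k}\right)(\tilde\mu_{r-1,k}-\tilde\mu_{r,k})\right],$$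 with initial conditions $\tilde\mu_{0,i}=\delta_{i,0}$ and, for $j\ge1$, $$\tilde\mu_{1,j}=\sum_{k=0}^{j}\binom{j}{k}\tilde\mu_{1,k}\left[\,1-a(p)\left(\ell^{j-k}-p^{m_2}(\ell+m_2)^{j-k}\right)\right]+q\,a(p)\sum_{k=\ell+1}^{\ell+m_2}k^j p^{k-\ell-1}.$$
   Context: Let $\zeta_1,\zeta_2,\dots$ be independent with $P(\zeta_i=1)=p$ and $P(\zeta_i=0)=q=1-p$. $H^n_{\ell_1,\ell_2,k_2}$ is the number of occurrences of the following pattern within $\zeta_1,\dots,\zeta_n$: at least $\ell_1$ consecutive 0's, immediately followed by exactly $i$ consecutive 1's for some $\ell_2\le i\le k_2$, immediately followed by a 0, where this terminating 0 is at a position $\le n$. (The pattern is counted only when the terminating 0 occurs, so a final block of 1's not yet ended by a 0 within the first $n$ trials is not counted.) Equivalently, $H^n_{\ell_1,\ell_2,k_2}$ is the number of positions $m\ge1$ for which there is $t\in\{0,\dots,k_2-\ell_2\}$ with $m+t+\ell_1+\ell_2\le n$, $\zeta_m=\dots=\zeta_{m+\ell_1-1}=0$, $\zeta_{m+\ell_1}=\dots=\zeta_{m+\ell_1+\ell_2+t-1}=1$ and $\zeta_{m+\ell_1+\ell_2+t}=0$. For example, for the sequence 00111101100010100011 of length 20, $H^{20}_{1,1,2}=3$, $H^{20}_{3,1,2}=1$, $H^{20}_{2,2,2}=0$, $H^{20}_{1,4,4}=1$. The $r$-th waiting time is $\rho_r=\min\{n\ge0: H^n_{\ell_1,\ell_2,k_2}=r\}$,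 with $\rho_0=0$. $g_r(m)$ is defined for all integers $m$ (zero for negative $m$). *)

theory Defs
  imports "HOL-Probability.Probability"
begin

text \<open>
  Trials are indexed from 1; \<open>x 0\<close> is never read. An occurrence is identified by the starting
  position \<open>m\<close> of the last \<open>l1\<close> zeros before the block of ones, and it is counted only when the
  zero that ends the block of ones is at a position \<open>\<le> n\<close>.
\<close>

definition pattern_count :: "nat \<Rightarrow> nat \<Rightarrow> nat \<Rightarrow> (nat \<Rightarrow> nat) \<Rightarrow> nat \<Rightarrow> nat" where
  "pattern_count l1 l2 k2 x n =
     card {m. 1 \<le> m \<and>
       (\<exists>t\<le>k2 - l2. m + t + l1 + l2 \<le> n \<and>
          (\<forall>i<l1. x (m + i) = 0) \<and>
          (\<forall>i<l2 + t. x (m + l1 + i) = 1) \<and>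
          x (m + l1 + l2 + t) = 0)}"

text \<open>The infimum over the empty set is \<open>\<infinity>\<close>: the \<open>r\<close>-th occurrence may never happen.\<close>

definition waiting_time :: "nat \<Rightarrow> nat \<Rightarrow> nat \<Rightarrow> (nat \<Rightarrow> nat) \<Rightarrow> nat \<Rightarrow> enat" where
  "waiting_time l1 l2 k2 x r = (INF n\<in>{n. pattern_count l1 l2 k2 x n = r}. enat n)"

text \<open>
  The event \<open>W = \<infinity>\<close> contributes 0 to the generating function, so that its value at \<open>t = 1\<close> is the
  probability that \<open>W\<close> is finite. The mass function has an integer argument and vanishes at
  negative arguments.
\<close>

definition prob_gen_fun :: "'a measure \<Rightarrow> ('a \<Rightarrow> enat) \<Rightarrow> complex \<Rightarrow> complex" where
  "prob_gen_fun M W t = (LINT \<omega>|M. (case W \<omega> of enat n \<Rightarrow> t ^ n | \<infinity> \<Rightarrow> 0))"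

definition prob_mass_fun :: "'a measure \<Rightarrow> ('a \<Rightarrow> enat) \<Rightarrow> int \<Rightarrow> real" where
  "prob_mass_fun M W m = measure M {\<omega> \<in> space M. \<exists>n. W \<omega> = enat n \<and> int n = m}"

definition moment :: "'a measure \<Rightarrow> ('a \<Rightarrow> enat) \<Rightarrow> nat \<Rightarrow> ennreal" where
  "moment M W j = (\<integral>\<^sup>+ \<omega>. ennreal_of_enat (W \<omega>) ^ j \<partial>M)"

end

theory Submission
  imports Defs "HOL-Complex_Analysis.Complex_Analysis"
begin

text \<open>
  Let \<open>N n\<close> be the number of occurrences up to time \<open>n\<close>, and let \<open>G r\<close>, \<open>V r\<close>, \<open>B r\<close> be
  the generating series in \<open>X\<close> of \<open>P(\<rho> r = n)\<close>, \<open>P(N n = r)\<close> and \<open>P(N n = r, \<zeta> n = 0)\<close>.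
  Since \<open>N\<close> has jumps of size one, \<open>(1 - X) V r = G r - G (r + 1)\<close>. A trial with outcome 1
  completes nothing, so \<open>B r = (1 - p X) V r - \<delta>\<close> with \<open>\<delta> = 1\<close> for \<open>r = 0\<close> and \<open>\<delta> = 0\<close>
  otherwise. Nothing is completed strictly inside an occurrence, so the count just before its
  end is the count at its first zero: \<open>G (r + 1) = a X^l (\<Sum>t<m2. (p X)^t) B r\<close>.
  Eliminating \<open>V\<close> and \<open>B\<close> gives \<open>D G (r + 1) = N' G r\<close> for \<open>r \<ge> 1\<close>, where
  \<open>N' = a X^l (1 - (p X)^m2)\<close> and \<open>D = 1 - X + N'\<close>, and a similar equation for \<open>G 1\<close>.

  The coefficients of \<open>G 1\<close> are summable, so its equation holds pointwise on the closed unit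
  disc. A zero \<open>z\<close> of \<open>D\<close> there would satisfy \<open>z N' = 0\<close>, hence \<open>z = 0\<close>, where \<open>D\<close> is 1; so
  \<open>D\<close> has no zero on some disc of radius greater than 1. Therefore \<open>G r\<close> converges beyond 1,
  all moments are finite, and \<open>G r\<close> takes the value 1 at 1, which means that the waiting times
  are almost surely finite.
\<close>

section \<open>Occurrences in a fixed sequence\<close>

text \<open>The trial before \<open>m\<close> is left free, which is how "at least \<open>l1\<close>
  zeros" is encoded; \<open>t\<close> is the surplus of ones over \<open>l2\<close>.\<close>

definition occurrence :: "nat \<Rightarrow> nat \<Rightarrow> (nat \<Rightarrow> nat) \<Rightarrow> nat \<Rightarrow> nat \<Rightarrow> bool" where
  "occurrence l1 l2 x m t \<longleftrightarrow>
     (\<forall>i<l1. x (m + i) = 0) \<and> (\<forall>i<l2 + t. x (m + l1 + i) = 1) \<and> x (m + l1 + l2 + t) = 0"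

definition completes :: "nat \<Rightarrow> nat \<Rightarrow> nat \<Rightarrow> (nat \<Rightarrow> nat) \<Rightarrow> nat \<Rightarrow> bool" where
  "completes l1 l2 k2 x n \<longleftrightarrow>
     (\<exists>m\<ge>1. \<exists>t\<le>k2 - l2. m + t + l1 + l2 = n \<and> occurrence l1 l2 x m t)"

lemma occurrenceD:
  assumes "occurrence l1 l2 x m t"
  shows "i < l1 \<Longrightarrow> x (m + i) = 0" and "i < l2 + t \<Longrightarrow> x (m + l1 + i) = 1"
    and "x (m + l1 + l2 + t) = 0"
  using assms by (auto simp: occurrence_def)

lemma pattern_count_altdef:
  "pattern_count l1 l2 k2 x n =
     card {m. 1 \<le> m \<and> (\<exists>t\<le>k2 - l2. m + t + l1 + l2 \<le> n \<and> occurrence l1 l2 x m t)}"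
  unfolding pattern_count_def occurrence_def by meson

text \<open>The block of ones starting at \<open>m + l1\<close> stops at its first zero, so the
  start determines the surplus.\<close>

lemma occurrence_length_unique:
  assumes "occurrence l1 l2 x m t" and "occurrence l1 l2 x m t'"
  shows "t = t'"
proof -
  have "\<not> t < t'" if "occurrence l1 l2 x m t" "occurrence l1 l2 x m t'" for t t'
  proof
    assume "t < t'"
    then have "x (m + l1 + (l2 + t)) = 1"
      by (intro occurrenceD(2)[OF that(2)]) simp
    then show False
      using occurrenceD(3)[OF that(1)] by (simp add: add.assoc)
  qed
  from this[OF assms] this[OF assms(2,1)] show ?thesis by simp
qed

text \<open>If two occurrences end at the same position, the one with the larger surplus has a one
  where the other has the last of its \<open>l1\<close> zeros.\<close>

lemma occurrence_start_unique:
  assumes "occurrence l1 l2 x m t" and "occurrence l1 l2 x m' t'" and "m + t = m' + t'" and "1 \<le> l1"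
  shows "t = t'"
proof -
  have "\<not> t < t'"
    if "occurrence l1 l2 x m t" "occurrence l1 l2 x m' t'" "m + t = m' + t'" for m m' t t'
  proof
    assume "t < t'"
    then have "x (m' + l1 + (t' - t - 1)) = 1"
      by (intro occurrenceD(2)[OF that(2)]) simp
    moreover have "m' + l1 + (t' - t - 1) = m + (l1 - 1)"
      using that(3) \<open>t < t'\<close> \<open>1 \<le> l1\<close> by simp
    moreover have "x (m + (l1 - 1)) = 0"
      using \<open>1 \<le> l1\<close> by (intro occurrenceD(1)[OF that(1)]) simp
    ultimately show False by simp
  qed
  from this[OF assms(1-3)] this[OF assms(2,1) assms(3)[symmetric]] show ?thesis by simp
qed

section \<open>The counting function and its jumps\<close>

lemma pattern_count_0 [simp]: "pattern_count l1 l2 k2 x 0 = 0"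
proof -
  have "{m. 1 \<le> m \<and> (\<exists>t\<le>k2 - l2. m + t + l1 + l2 \<le> 0 \<and> occurrence l1 l2 x m t)} = {}"
    by auto
  then show ?thesis
    unfolding pattern_count_altdef by simp
qed

text \<open>At most one occurrence ends at \<open>Suc n\<close>, by uniqueness of the start. Its
  start was not counted before, by uniqueness of the length. Hence every jump has size one.\<close>

lemma pattern_count_Suc:
  assumes "1 \<le> l1"
  shows "pattern_count l1 l2 k2 x (Suc n) =
    pattern_count l1 l2 k2 x n + of_bool (completes l1 l2 k2 x (Suc n))"
proof -
  define S where
    "S n = {m. 1 \<le> m \<and> (\<exists>t\<le>k2 - l2. m + t + l1 + l2 \<le> n \<and> occurrence l1 l2 x m t)}" for n
  have fin: "finite (S n)" for n
    by (rule finite_subset[of _ "{..n}"]) (auto simp: S_def)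
  have S_Suc: "S (Suc n) =
      S n \<union> {m. 1 \<le> m \<and> (\<exists>t\<le>k2 - l2. m + t + l1 + l2 = Suc n \<and> occurrence l1 l2 x m t)}"
    unfolding S_def by (auto simp: le_Suc_eq)
  show ?thesis
  proof (cases "completes l1 l2 k2 x (Suc n)")
    case True
    then obtain m t where mt: "m \<ge> 1" "t \<le> k2 - l2" "m + t + l1 + l2 =
      Suc n" "occurrence l1 l2 x m t"
      unfolding completes_def by blast
    have "{m. 1 \<le> m \<and> (\<exists>t\<le>k2 - l2. m + t + l1 + l2 = Suc n \<and> occurrence l1 l2 x m t)} = {m}"
    proof (rule set_eqI)
      fix m'
      have "m' = m" if "m' + t' + l1 + l2 = Suc n" "occurrence l1 l2 x m' t'" for t'
      proof -
        have "m' + t' = m + t" using that(1) mt(3) by linarith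
        with occurrence_start_unique[OF that(2) mt(4) _ assms] show ?thesis by simp
      qed
      then show "m' \<in> {m. 1 \<le> m \<and> (\<exists>t\<le>k2 - l2. m + t + l1 + l2 = Suc n \<and> occurrence l1 l2 x m t)}
          \<longleftrightarrow> m' \<in> {m}"
        using mt by blast
    qed
    moreover have "m \<notin> S n"
    proof
      assume "m \<in> S n"
      then obtain t' where "m + t' + l1 + l2 \<le> n" "occurrence l1 l2 x m t'"
        unfolding S_def by blast
      with occurrence_length_unique[OF mt(4)] mt(3) show False by fastforce
    qed
    ultimately have "card (S (Suc n)) = Suc (card (S n))"
      unfolding S_Suc using fin by simp
    then show ?thesis
      using True by (simp add: pattern_count_altdef S_def)
  next
    case False
    then have "S (Suc n) = S n"
      unfolding S_Suc completes_def by blast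
    then show ?thesis
      using False by (simp add: pattern_count_altdef S_def)
  qed
qed

lemma occurrence_cong:
  assumes "\<And>i. i \<in> {m..m + l1 + l2 + t} \<Longrightarrow> x i = y i"
  shows "occurrence l1 l2 x m t \<longleftrightarrow> occurrence l1 l2 y m t"
  unfolding occurrence_def using assms by auto

lemma completes_cong:
  assumes "\<And>i. i \<in> {1..n} \<Longrightarrow> x i = y i"
  shows "completes l1 l2 k2 x n \<longleftrightarrow> completes l1 l2 k2 y n"
proof -
  have "occurrence l1 l2 x m t \<longleftrightarrow> occurrence l1 l2 y m t"
    if "1 \<le> m" "m + t + l1 + l2 = n" for m t
    by (rule occurrence_cong) (use that assms in auto)
  then show ?thesis
    unfolding completes_def by metis
qed

lemma pattern_count_cong:
  assumes "\<And>i. i \<in> {1..n} \<Longrightarrow> x i = y i"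
  shows "pattern_count l1 l2 k2 x n = pattern_count l1 l2 k2 y n"
proof -
  have *: "occurrence l1 l2 x m t \<longleftrightarrow> occurrence l1 l2 y m t"
    if "1 \<le> m" "m + t + l1 + l2 \<le> n" for m t
    by (rule occurrence_cong) (use that assms in auto)
  have "1 \<le> m \<and> (\<exists>t\<le>k2 - l2. m + t + l1 + l2 \<le> n \<and> occurrence l1 l2 x m t) \<longleftrightarrow>
        1 \<le> m \<and> (\<exists>t\<le>k2 - l2. m + t + l1 + l2 \<le> n \<and> occurrence l1 l2 y m t)" for m
    using *[of m] by blast
  then show ?thesis
    by (simp add: pattern_count_altdef)
qed

lemma not_completes_if_one: "x n = 1 \<Longrightarrow> \<not> completes l1 l2 k2 x n"
  unfolding completes_def occurrence_def by (auto simp: ac_simps)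

text \<open>The zero that ends an occurrence is directly preceded by a one, because the block of
  ones is nonempty.\<close>

lemma not_completes_after_zero:
  assumes "1 \<le> l2" and "x n = 0"
  shows "\<not> completes l1 l2 k2 x (Suc n)"
proof
  assume "completes l1 l2 k2 x (Suc n)"
  then obtain m t where mt: "m + t + l1 + l2 = Suc n" "occurrence l1 l2 x m t"
    unfolding completes_def by blast
  have "x (m + l1 + (l2 + t - 1)) = 1"
    using assms(1) by (intro occurrenceD(2)[OF mt(2)]) simp
  moreover have "m + l1 + (l2 + t - 1) = n"
    using mt(1) assms(1) by simp
  ultimately show False
    using assms(2) by simp
qed

lemma pattern_count_eq_if_not_completes:
  assumes "1 \<le> l1" and "n \<le> m" and "\<And>e. n < e \<Longrightarrow> e \<le> m \<Longrightarrow> \<not> completes l1 l2 k2 x e"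
  shows "pattern_count l1 l2 k2 x m = pattern_count l1 l2 k2 x n"
  using assms(2,3)
proof (induction m rule: dec_induct)
  case (step m)
  then show ?case
    using pattern_count_Suc[OF assms(1), of l2 k2 x m] by simp
qed simp

text \<open>A position strictly between the first zero and the final zero either follows a zero or
  carries a one, so nothing is completed there. The count just before the end is thus determined by
  the trials up to the first zero, which are independent of the rest of the occurrence.\<close>

lemma pattern_count_before_occurrence:
  assumes "1 \<le> l1" and "1 \<le> l2" and "occurrence l1 l2 x n t" and "Suc m = n + t + l1 + l2"
  shows "pattern_count l1 l2 k2 x m = pattern_count l1 l2 k2 x n"
proof (rule pattern_count_eq_if_not_completes)
  fix e assume e: "n < e" "e \<le> m"
  show "\<not> completes l1 l2 k2 x e"
  proof (cases "e < n + l1")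
    case True
    then have "x (n + (e - 1 - n)) = 0"
      using e by (intro occurrenceD(1)[OF assms(3)]) simp
    then have "x (e - 1) = 0"
      using e by simp
    then show ?thesis
      using not_completes_after_zero[OF assms(2), of x "e - 1"] e by simp
  next
    case False
    then have "e - n - l1 < l2 + t"
      using e assms(4) by simp
    then have "x (n + l1 + (e - n - l1)) = 1"
      by (rule occurrenceD(2)[OF assms(3)])
    then show ?thesis
      using not_completes_if_one False by simp
  qed
qed (use assms in simp_all)

section \<open>Waiting times of a fixed sequence\<close>

lemma waiting_time_eq_enat_iff:
  "waiting_time l1 l2 k2 x r = enat m \<longleftrightarrow>
    pattern_count l1 l2 k2 x m = r \<and> (\<forall>k<m. pattern_count l1 l2 k2 x k \<noteq> r)"
proof -
  let ?A = "{n. pattern_count l1 l2 k2 x n = r}"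
  show ?thesis
  proof (cases "?A = {}")
    case True
    then show ?thesis
      by (auto simp: waiting_time_def top_enat_def)
  next
    case False
    define n where "n = (LEAST n. n \<in> ?A)"
    have n: "n \<in> ?A" "\<And>k. k \<in> ?A \<Longrightarrow> n \<le> k"
      unfolding n_def using False by (auto intro: LeastI Least_le)
    have "(INF n\<in>?A. enat n) = enat n"
      using n by (intro antisym INF_lower INF_greatest) auto
    then have "waiting_time l1 l2 k2 x r = enat n"
      by (simp add: waiting_time_def)
    then show ?thesis
      using n by (metis (mono_tags, lifting) antisym_conv3 enat.inject leD mem_Collect_eq)
  qed
qed

lemma waiting_time_0 [simp]: "waiting_time l1 l2 k2 x 0 = enat 0"
  by (simp add: waiting_time_eq_enat_iff)

lemma waiting_time_Suc_neq_0: "waiting_time l1 l2 k2 x (Suc r) \<noteq> enat 0"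
  by (simp add: waiting_time_eq_enat_iff)

lemma pattern_count_mono:
  assumes "1 \<le> l1" and "m \<le> n"
  shows "pattern_count l1 l2 k2 x m \<le> pattern_count l1 l2 k2 x n"
  using assms(2) by (rule lift_Suc_mono_le[rotated]) (simp add: pattern_count_Suc[OF assms(1)])

text \<open>The count moves by unit jumps, so \<open>Suc r\<close> is reached from \<open>r\<close>
  by a completion; monotonicity rules out an earlier visit to \<open>Suc r\<close>.\<close>

lemma waiting_time_Suc_eq_iff:
  assumes "1 \<le> l1"
  shows "waiting_time l1 l2 k2 x (Suc r) = enat (Suc n) \<longleftrightarrow>
    pattern_count l1 l2 k2 x n = r \<and> completes l1 l2 k2 x (Suc n)"
proof
  assume "waiting_time l1 l2 k2 x (Suc r) = enat (Suc n)"
  then have "pattern_count l1 l2 k2 x (Suc n) = Suc r" "pattern_count l1 l2 k2 x n \<noteq> Suc r"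
    by (simp_all add: waiting_time_eq_enat_iff)
  then show "pattern_count l1 l2 k2 x n = r \<and> completes l1 l2 k2 x (Suc n)"
    by (cases "completes l1 l2 k2 x (Suc n)") (simp_all add: pattern_count_Suc[OF assms])
next
  assume *: "pattern_count l1 l2 k2 x n = r \<and> completes l1 l2 k2 x (Suc n)"
  have "pattern_count l1 l2 k2 x k \<noteq> Suc r" if "k < Suc n" for k
    using pattern_count_mono[OF assms, of k n l2 k2 x] that * by simp
  with * show "waiting_time l1 l2 k2 x (Suc r) = enat (Suc n)"
    by (simp add: waiting_time_eq_enat_iff pattern_count_Suc[OF assms])
qed

section \<open>Independent trials\<close>

text \<open>This plays the role of membership in the sigma-algebra of the first \<open>n\<close>
  trials, but is stated on sequences, so that it can be checked without measure theory.\<close>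

definition depends_upto :: "nat \<Rightarrow> ((nat \<Rightarrow> 'b) \<Rightarrow> bool) \<Rightarrow> bool" where
  "depends_upto n A \<longleftrightarrow> (\<forall>x y. (\<forall>i\<in>{1..n}. x i = y i) \<longrightarrow> A x = A y)"

lemma depends_uptoI [intro?]:
  "(\<And>x y. (\<And>i. i \<in> {1..n} \<Longrightarrow> x i = y i) \<Longrightarrow> A x = A y) \<Longrightarrow> depends_upto n A"
  unfolding depends_upto_def by blast

lemma depends_uptoD:
  "depends_upto n A \<Longrightarrow> (\<And>i. i \<in> {1..n} \<Longrightarrow> x i = y i) \<Longrightarrow> A x = A y"
  unfolding depends_upto_def by blast

lemma depends_upto_conj:
  "depends_upto n A \<Longrightarrow> depends_upto n B \<Longrightarrow> depends_upto n (\<lambda>x. A x \<and> B x)"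
  unfolding depends_upto_def by blast

lemma depends_upto_disj:
  "depends_upto n A \<Longrightarrow> depends_upto n B \<Longrightarrow> depends_upto n (\<lambda>x. A x \<or> B x)"
  unfolding depends_upto_def by blast

lemma depends_upto_not: "depends_upto n A \<Longrightarrow> depends_upto n (\<lambda>x. \<not> A x)"
  unfolding depends_upto_def by blast

lemma depends_upto_nth: "1 \<le> i \<Longrightarrow> i \<le> n \<Longrightarrow> depends_upto n (\<lambda>x. Q (x i))"
  unfolding depends_upto_def by simp

lemma depends_upto_run:
  fixes A :: "(nat \<Rightarrow> 'b) \<Rightarrow> bool"
  assumes "depends_upto n A"
  shows "depends_upto (n + k) (\<lambda>x. A x \<and> (\<forall>i<k. x (Suc n + i) = c))"
proof
  fix x y :: "nat \<Rightarrow> 'b"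
  assume xy: "\<And>i. i \<in> {1..n + k} \<Longrightarrow> x i = y i"
  have "A x = A y"
    by (rule depends_uptoD[OF assms]) (use xy in auto)
  moreover have "x (Suc n + i) = y (Suc n + i)" if "i < k" for i
    using that by (intro xy) auto
  ultimately show "(A x \<and> (\<forall>i<k. x (Suc n + i) = c)) = (A y \<and> (\<forall>i<k. y (Suc n + i) = c))"
    by simp
qed

locale nat_trials = prob_space M for M :: "'a measure" +
  fixes \<zeta> :: "nat \<Rightarrow> 'a \<Rightarrow> nat"
  assumes indep: "indep_vars (\<lambda>_. count_space UNIV) \<zeta> {1..}"
begin

definition event :: "((nat \<Rightarrow> nat) \<Rightarrow> bool) \<Rightarrow> 'a set" where
  "event A = {\<omega> \<in> space M. A (\<lambda>i. \<zeta> i \<omega>)}"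

lemma measurable_trial: "1 \<le> i \<Longrightarrow> \<zeta> i \<in> M \<rightarrow>\<^sub>M count_space UNIV"
  using indep by (simp add: indep_vars_def)

text \<open>A finite product of countable discrete spaces is again discrete.\<close>

lemma measurable_PiM_count_space:
  "finite I \<Longrightarrow> f \<in> PiM I (\<lambda>_. count_space (UNIV :: nat set)) \<rightarrow>\<^sub>M count_space UNIV"
  by (simp add: count_space_PiM_finite)

lemma event_eq_restrict:
  assumes "depends_upto n A"
  shows "event A = {\<omega> \<in> space M. A (restrict (\<lambda>i. \<zeta> i \<omega>) {1..n})}"
proof -
  have "A (\<lambda>i. \<zeta> i \<omega>) = A (restrict (\<lambda>i. \<zeta> i \<omega>) {1..n})" for \<omega>
    by (rule depends_uptoD[OF assms]) simp
  then show ?thesis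
    unfolding event_def by blast
qed

lemma sets_event:
  assumes "depends_upto n A"
  shows "event A \<in> sets M"
proof -
  have "(\<lambda>\<omega>. restrict (\<lambda>i. \<zeta> i \<omega>) {1..n}) \<in> M \<rightarrow>\<^sub>M PiM {1..n} (\<lambda>_. count_space UNIV)"
    by (rule measurable_restrict, rule measurable_trial) simp
  from measurable_compose[OF this measurable_PiM_count_space[of "{1..n}" A]]
  have "Measurable.pred M (\<lambda>\<omega>. A (restrict (\<lambda>i. \<zeta> i \<omega>) {1..n}))"
    by simp
  then show ?thesis
    unfolding event_eq_restrict[OF assms] by (rule predE)
qed

text \<open>The blocks of trials \<open>{1..n}\<close> and \<open>{Suc n}\<close> are disjoint,
  hence independent as groups, and the two conditions are functions of one block each.\<close>

lemma prob_event_Suc: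
  assumes A: "depends_upto n A"
  shows "prob (event (\<lambda>x. A x \<and> x (Suc n) = c)) = prob (event A) * prob (event (\<lambda>x. x (Suc n) = c))"
proof -
  let ?P = "\<lambda>I. PiM I (\<lambda>_. count_space (UNIV :: nat set))"
  let ?X = "\<lambda>\<omega>. restrict (\<lambda>i. \<zeta> i \<omega>) {1..n}" and ?Y = "\<lambda>\<omega>. restrict (\<lambda>i. \<zeta> i \<omega>) {Suc n}"
  have "indep_var (?P {1..n}) ?X (?P {Suc n}) ?Y"
    by (rule indep_var_restrict[OF indep]) auto
  from indep_var_compose[OF this measurable_PiM_count_space[of "{1..n}" A]
      measurable_PiM_count_space[of "{Suc n}" "\<lambda>x. x (Suc n) = c"]]
  have "indep_var (count_space UNIV) (\<lambda>\<omega>. A (?X \<omega>)) (count_space UNIV) (\<lambda>\<omega>. \<zeta> (Suc n) \<omega> = c)"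
    by (simp add: o_def)
  from indep_varD[OF this, of "{True}" "{True}"]
  have "prob ((\<lambda>\<omega>. (A (?X \<omega>), \<zeta> (Suc n) \<omega> = c)) -` ({True} \<times> {True}) \<inter> space M) =
    prob ((\<lambda>\<omega>. A (?X \<omega>)) -` {True} \<inter> space M) * prob ((\<lambda>\<omega>. \<zeta> (Suc n) \<omega> = c) -` {True} \<inter> space M)"
    by simp
  also have "(\<lambda>\<omega>. A (?X \<omega>)) -` {True} \<inter> space M = event A"
    unfolding event_eq_restrict[OF A] by auto
  also have "(\<lambda>\<omega>. \<zeta> (Suc n) \<omega> = c) -` {True} \<inter> space M = event (\<lambda>x. x (Suc n) = c)"
    unfolding event_def by auto
  also have "(\<lambda>\<omega>. (A (?X \<omega>), \<zeta> (Suc n) \<omega> = c)) -` ({True} \<times> {True}) \<inter> space M =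
      event A \<inter> event (\<lambda>x. x (Suc n) = c)"
    unfolding event_eq_restrict[OF A] by (auto simp: event_def)
  also have "\<dots> = event (\<lambda>x. A x \<and> x (Suc n) = c)"
    by (auto simp: event_def)
  finally show ?thesis .
qed

lemma prob_event_run:
  assumes "depends_upto n A" and c: "\<And>i. 1 \<le> i \<Longrightarrow> prob (event (\<lambda>x. x i = c)) = s"
  shows "prob (event (\<lambda>x. A x \<and> (\<forall>i<k. x (Suc n + i) = c))) = prob (event A) * s ^ k"
proof (induction k)
  case (Suc k)
  have "prob (event (\<lambda>x. A x \<and> (\<forall>i<Suc k. x (Suc n + i) = c))) =
      prob (event (\<lambda>x. (A x \<and> (\<forall>i<k. x (Suc n + i) = c)) \<and> x (Suc (n + k)) = c))"
    by (rule arg_cong[where f = "\<lambda>A. prob (event A)"]) (auto simp: less_Suc_eq)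
  also have "\<dots> = prob (event (\<lambda>x. A x \<and> (\<forall>i<k. x (Suc n + i) = c))) * s"
    using c by (subst prob_event_Suc[OF depends_upto_run[OF assms(1)]]) simp
  finally show ?case
    using Suc.IH by simp
qed simp

end

section \<open>Power series with a polynomial denominator\<close>

text \<open>Multiplication by \<open>fps_X ^ i\<close> puts \<open>i\<close> zeros in front of the
  coefficients. The weight \<open>w\<close> is kept general to cover both \<open>z ^ n\<close> and
  \<open>n ^ j\<close>.\<close>

lemma sums_fps_X_power_mult:
  fixes F :: "'b::real_normed_field fps"
  assumes "(\<lambda>n. w (n + i) * fps_nth F n) sums s"
  shows "(\<lambda>n. w n * fps_nth (fps_X ^ i * F) n) sums s"
  using assms by (subst sums_zero_iff_shift[of i, symmetric]) (auto simp: fps_X_power_mult_nth)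

text \<open>Induction along Horner's scheme. Only convergence at the single point \<open>z\<close>
  enters, so boundary points of the disc are covered.\<close>

lemma sums_fps_of_poly_mult:
  fixes F :: "'b::real_normed_field fps"
  assumes "(\<lambda>n. fps_nth F n * z ^ n) sums s"
  shows "(\<lambda>n. fps_nth (fps_of_poly P * F) n * z ^ n) sums (poly P z * s)"
proof (induction P)
  case (pCons c P)
  have "(\<lambda>n. z ^ (n + 1) * fps_nth (fps_of_poly P * F) n) sums (z * (poly P z * s))"
    using sums_mult[OF pCons.IH, of z] by (simp add: mult_ac)
  from sums_fps_X_power_mult[OF this]
  have "(\<lambda>n. fps_nth (fps_X * (fps_of_poly P * F)) n * z ^ n) sums (z * (poly P z * s))"
    by (simp add: mult_ac)
  from sums_add[OF sums_mult[OF assms, of c] this] show ?case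
    by (simp add: fps_of_poly_pCons algebra_simps)
qed simp

text \<open>Expanding \<open>(n + i) ^ j\<close> by the binomial theorem produces the binomial
  coefficients of the moment recurrences.\<close>

lemma sums_moment_shift:
  fixes F :: "'b::real_normed_field fps"
  assumes "\<And>k. k \<le> j \<Longrightarrow> (\<lambda>n. of_nat n ^ k * fps_nth F n) sums \<mu> k"
  shows "(\<lambda>n. of_nat n ^ j * fps_nth (fps_X ^ i * F) n) sums
    (\<Sum>k\<le>j. of_nat (j choose k) * of_nat i ^ (j - k) * \<mu> k)"
proof (rule sums_fps_X_power_mult)
  have "(\<lambda>n. \<Sum>k\<le>j. of_nat (j choose k) * of_nat i ^ (j - k) * (of_nat n ^ k * fps_nth F n)) sums
    (\<Sum>k\<le>j. of_nat (j choose k) * of_nat i ^ (j - k) * \<mu> k)"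
    by (intro sums_sum sums_mult assms) simp
  also have "(\<lambda>n. \<Sum>k\<le>j. of_nat (j choose k) * of_nat i ^ (j - k) * (of_nat n ^ k * fps_nth F n)) =
    (\<lambda>n. of_nat (n + i) ^ j * fps_nth F n)"
    by (simp add: binomial_ring sum_distrib_right sum_distrib_left mult_ac)
  finally show "(\<lambda>n. of_nat (n + i) ^ j * fps_nth F n) sums
    (\<Sum>k\<le>j. of_nat (j choose k) * of_nat i ^ (j - k) * \<mu> k)" .
qed

text \<open>The operator \<open>fps_XD\<close> multiplies the \<open>n\<close>-th coefficient by
  \<open>n\<close> and does not shrink the radius of convergence; a radius above 1 gives absolute
  convergence at 1.\<close>

lemma summable_moments_fps:
  fixes F :: "complex fps"
  assumes "1 < fps_conv_radius F"
  shows "summable (\<lambda>n. norm (of_nat n ^ j * fps_nth F n))"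
proof -
  have "fps_conv_radius ((fps_XD ^^ j) F) \<ge> fps_conv_radius F"
  proof (induction j)
    case (Suc j)
    have "fps_conv_radius (fps_X * fps_deriv ((fps_XD ^^ j) F)) \<ge> fps_conv_radius F"
      by (intro fps_conv_radius_mult_ge order.trans[OF Suc.IH fps_conv_radius_deriv]) simp
    also have "fps_X * fps_deriv ((fps_XD ^^ j) F) = fps_XD ((fps_XD ^^ j) F)"
      by (simp only: fps_XD_def o_apply)
    finally show ?case
      by simp
  qed simp
  with assms have "ereal (norm (1 :: complex)) < fps_conv_radius ((fps_XD ^^ j) F)"
    by (simp add: one_ereal_def[symmetric])
  from norm_summable_fps[OF this] have "summable (\<lambda>n. norm (fps_nth ((fps_XD ^^ j) F) n))"
    by simp
  moreover have "fps_nth ((fps_XD ^^ j) F) n = of_nat n ^ j * fps_nth F n" for n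
    by (induction j) (auto simp: fps_XD_def gr0_conv_Suc)
  ultimately show ?thesis
    by simp
qed

text \<open>The zero set is closed and disjoint from the compact unit disc, hence at some distance
  \<open>d > 0\<close> from it, and \<open>1 + d\<close> serves as radius.\<close>

lemma poly_nonzero_on_larger_disc:
  fixes P :: "complex poly"
  assumes "\<And>z. norm z \<le> 1 \<Longrightarrow> poly P z \<noteq> 0"
  obtains R where "1 < R" and "\<And>z. norm z < R \<Longrightarrow> poly P z \<noteq> 0"
proof -
  have "closed {z. poly P z = 0}"
    by (intro closed_Collect_eq continuous_intros)
  then obtain d where d: "d > 0" "\<And>x y. x \<in> cball 0 1 \<Longrightarrow> poly P y = 0 \<Longrightarrow> d \<le> dist x y"
    using separate_compact_closed[of "cball (0 :: complex) 1" "{z. poly P z = 0}"] assms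
    by fastforce
  have "poly P z \<noteq> 0" if "norm z < 1 + d" for z
  proof
    assume z: "poly P z = 0"
    then have "norm z > 1"
      using assms[of z] by fastforce
    \<comment> \<open>\<open>sgn z\<close> is the radial projection of \<open>z\<close> to the unit
      circle, so a zero \<open>z\<close> of norm below \<open>1 + d\<close> would be closer than
      \<open>d\<close> to the disc.\<close>
    moreover have "sgn z \<in> cball 0 1"
      by (simp add: norm_sgn)
    moreover have "dist (sgn z) z = norm z - 1"
    proof -
      have "z \<noteq> 0"
        using \<open>norm z > 1\<close> by auto
      have "norm z *\<^sub>R sgn z = z"
        using \<open>z \<noteq> 0\<close> by (simp add: sgn_div_norm)
      then have "z - sgn z = (norm z - 1) *\<^sub>R sgn z"
        by (simp add: scaleR_diff_left)
      then have "norm (z - sgn z) = norm z - 1"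
        using \<open>norm z > 1\<close> \<open>z \<noteq> 0\<close> by (simp add: norm_sgn)
      then show ?thesis
        by (simp add: dist_norm norm_minus_commute)
    qed
    ultimately show False
      using d(2)[of "sgn z" z] z that by simp
  qed
  then show ?thesis
    using that[of "1 + d"] d(1) by simp
qed

lemma fps_conv_radius_inverse_poly:
  fixes P :: "complex poly"
  assumes "\<And>z. norm z < R \<Longrightarrow> poly P z \<noteq> 0"
  shows "ereal R \<le> fps_conv_radius (inverse (fps_of_poly P))"
  using fps_conv_radius_inverse[of "ereal R" "fps_of_poly P"] assms by simp

section \<open>Waiting times in the extended naturals\<close>

text \<open>Both integrands are expanded over the disjoint events \<open>W = n\<close>, where at
  most one term is nonzero at each point. The value 0 at infinity agrees with the empty sum for the
  generating function. For the moments, infinity has to be a null event, which is what total mass 1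
  on the finite values provides.\<close>

lemma
  fixes W :: "'a \<Rightarrow> enat"
  assumes "prob_space M" and W: "\<And>n. {\<omega> \<in> space M. W \<omega> = enat n} \<in> sets M"
  shows prob_gen_fun_eq_suminf:
      "norm t \<le> 1 \<Longrightarrow>
       prob_gen_fun M W t = (\<Sum>n. of_real (measure M {\<omega> \<in> space M. W \<omega> = enat n}) * t ^ n)"
    and moment_eq_suminf:
      "(\<lambda>n. measure M {\<omega> \<in> space M. W \<omega> = enat n}) sums 1 \<Longrightarrow>
       summable (\<lambda>n. real n ^ j * measure M {\<omega> \<in> space M. W \<omega> = enat n}) \<Longrightarrow>
       moment M W j = ennreal (\<Sum>n. real n ^ j * measure M {\<omega> \<in> space M. W \<omega> = enat n})"
proof -
  interpret prob_space M by fact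
  define E where "E n = {\<omega> \<in> space M. W \<omega> = enat n}" for n
  have E [measurable]: "E n \<in> sets M" for n
    using W by (simp add: E_def)
  have disj: "disjoint_family E"
    by (auto simp: disjoint_family_on_def E_def)
  have sum_prob: "(\<lambda>n. prob (E n)) sums prob (\<Union>n. E n)"
    using E disj by (intro finite_measure_UNION) auto
  show "prob_gen_fun M W t = (\<Sum>n. of_real (measure M {\<omega> \<in> space M. W \<omega> = enat n}) * t ^ n)"
    if t: "norm t \<le> 1"
  proof -
    let ?f = "\<lambda>n \<omega>. indicat_real (E n) \<omega> *\<^sub>R t ^ n"
    have eq: "(case W \<omega> of enat n \<Rightarrow> t ^ n | \<infinity> \<Rightarrow> 0) = (\<Sum>n. ?f n \<omega>)"
      and summ: "summable (\<lambda>n. norm (?f n \<omega>))"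
      if "\<omega> \<in> space M" for \<omega>
    proof -
      show "(case W \<omega> of enat n \<Rightarrow> t ^ n | \<infinity> \<Rightarrow> 0) = (\<Sum>n. ?f n \<omega>)"
      proof (cases "W \<omega>")
        case (enat k)
        have "(\<Sum>n. ?f n \<omega>) = (\<Sum>n\<in>{k}. ?f n \<omega>)"
          by (rule suminf_finite) (auto simp: E_def enat)
        then show ?thesis
          using that enat by (simp add: E_def)
      next
        case infinity
        then have "indicat_real (E n) \<omega> = 0" for n
          by (simp add: E_def)
        then show ?thesis
          using infinity by simp
      qed
      show "summable (\<lambda>n. norm (?f n \<omega>))"
        by (rule summable_finite[of "case W \<omega> of enat k \<Rightarrow> {k} | \<infinity> \<Rightarrow> {}"])
           (auto simp: E_def split: enat.splits)
    qed
    have "prob_gen_fun M W t = (LINT \<omega>|M. (\<Sum>n. ?f n \<omega>))"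
      unfolding prob_gen_fun_def by (intro Bochner_Integration.integral_cong refl eq)
    also have "\<dots> = (\<Sum>n. LINT \<omega>|M. ?f n \<omega>)"
    proof (rule integral_suminf)
      show "integrable M (?f n)" for n
        by (intro integrable_scaleR_left) (simp add: emeasure_eq_measure)
      show "AE \<omega> in M. summable (\<lambda>n. norm (?f n \<omega>))"
        using summ by (intro AE_I2)
      have "(LINT \<omega>|M. norm (?f n \<omega>)) = prob (E n) * norm t ^ n" for n
        by (simp add: norm_power)
      moreover have "summable (\<lambda>n. prob (E n) * norm t ^ n)"
        by (rule summable_comparison_test'[OF sums_summable[OF sum_prob], of 0])
           (use t in \<open>auto intro!: mult_left_le power_le_one\<close>)
      ultimately show "summable (\<lambda>n. LINT \<omega>|M. norm (?f n \<omega>))"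
        by (simp only:)
    qed
    also have "\<dots> = (\<Sum>n. of_real (prob (E n)) * t ^ n)"
      by (simp add: scaleR_conv_of_real)
    finally show ?thesis
      by (simp add: E_def)
  qed
  have AE: "AE \<omega> in M. W \<omega> \<noteq> \<infinity>" if "(\<lambda>n. measure M {\<omega> \<in> space M. W \<omega> = enat n}) sums 1"
  proof -
    have "prob (\<Union>n. E n) = 1"
      using sums_unique2[OF sum_prob] that by (simp add: E_def)
    then have "AE \<omega> in M. \<omega> \<in> (\<Union>n. E n)"
      by (subst prob_eq_1[symmetric]) auto
    then show ?thesis
      by (rule eventually_mono) (auto simp: E_def)
  qed
  show "moment M W j = ennreal (\<Sum>n. real n ^ j * measure M {\<omega> \<in> space M. W \<omega> = enat n})"
    if "(\<lambda>n. measure M {\<omega> \<in> space M. W \<omega> = enat n}) sums 1"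
      "summable (\<lambda>n. real n ^ j * measure M {\<omega> \<in> space M. W \<omega> = enat n})"
  proof -
    let ?f = "\<lambda>n \<omega>. ennreal (real n ^ j) * indicator (E n) \<omega>"
    have "moment M W j = (\<integral>\<^sup>+\<omega>. (\<Sum>n. ?f n \<omega>) \<partial>M)"
      unfolding moment_def
    proof (rule nn_integral_cong_AE)
      have *: "ennreal_of_enat (W \<omega>) ^ j = (\<Sum>n. ?f n \<omega>)" if fin: "W \<omega> \<noteq> \<infinity>" and "\<omega> \<in> space M" for \<omega>
      proof -
        obtain k where k: "W \<omega> = enat k"
          using fin by auto
        have "(\<Sum>n. ?f n \<omega>) = (\<Sum>n\<in>{k}. ?f n \<omega>)"
          by (rule suminf_finite) (auto simp: E_def k)
        then show ?thesis
          using that k by (simp add: E_def ennreal_power ennreal_of_nat_eq_real_of_nat)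
      qed
      show "AE \<omega> in M. ennreal_of_enat (W \<omega>) ^ j = (\<Sum>n. ?f n \<omega>)"
        using AE[OF that(1)] AE_space by eventually_elim (rule *)
    qed
    also have "\<dots> = (\<Sum>n. \<integral>\<^sup>+\<omega>. ?f n \<omega> \<partial>M)"
      by (rule nn_integral_suminf) measurable
    also have "\<dots> = (\<Sum>n. ennreal (real n ^ j * prob (E n)))"
      by (simp add: nn_integral_cmult_indicator emeasure_eq_measure ennreal_mult)
    also have "\<dots> = ennreal (\<Sum>n. real n ^ j * prob (E n))"
      using that(2) by (intro suminf_ennreal2) (auto simp: E_def)
    finally show ?thesis
      by (simp add: E_def)
  qed
qed

section \<open>Waiting times for the pattern\<close>

locale pattern_trials = nat_trials +
  fixes p q :: real and l1 l2 k2 :: nat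
  assumes prob_one: "\<And>i. 1 \<le> i \<Longrightarrow> prob (event (\<lambda>x. x i = 1)) = p"
    and prob_zero: "\<And>i. 1 \<le> i \<Longrightarrow> prob (event (\<lambda>x. x i = 0)) = q"
    and p_pos: "0 < p" and p_less_1: "p < 1" and q_def: "q = 1 - p"
    and l1_pos: "1 \<le> l1" and l2_pos: "1 \<le> l2"
begin

section \<open>Probabilities of counts and of completions\<close>

abbreviation count :: "(nat \<Rightarrow> nat) \<Rightarrow> nat \<Rightarrow> nat" where
  "count \<equiv> pattern_count l1 l2 k2"

abbreviation wait :: "(nat \<Rightarrow> nat) \<Rightarrow> nat \<Rightarrow> enat" where
  "wait \<equiv> waiting_time l1 l2 k2"

definition wait_prob :: "nat \<Rightarrow> nat \<Rightarrow> real" where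
  "wait_prob r n = prob (event (\<lambda>x. wait x r = enat n))"

definition count_prob :: "nat \<Rightarrow> nat \<Rightarrow> real" where
  "count_prob r n = prob (event (\<lambda>x. count x n = r))"

text \<open>The conjunct \<open>1 \<le> n\<close> sets the value at \<open>n = 0\<close> to 0, since
  trial 0 does not belong to the model.\<close>

definition count_zero_prob :: "nat \<Rightarrow> nat \<Rightarrow> real" where
  "count_zero_prob r n = prob (event (\<lambda>x. count x n = r \<and> 1 \<le> n \<and> x n = 0))"

lemma depends_upto_count: "n \<le> m \<Longrightarrow> depends_upto m (\<lambda>x. Q (count x n))"
  by (rule depends_uptoI, rule arg_cong[where f = Q]) (auto intro!: pattern_count_cong)

lemma depends_upto_completes: "depends_upto n (\<lambda>x. completes l1 l2 k2 x n)"
  by (rule depends_uptoI) (rule completes_cong)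

lemma depends_upto_wait: "depends_upto n (\<lambda>x. wait x r = enat n)"
proof
  fix x y :: "nat \<Rightarrow> nat"
  assume "\<And>i. i \<in> {1..n} \<Longrightarrow> x i = y i"
  then have "count x k = count y k" if "k \<le> n" for k
    using that by (intro pattern_count_cong) auto
  then show "(wait x r = enat n) = (wait y r = enat n)"
    by (simp add: waiting_time_eq_enat_iff)
qed

lemma sets_wait: "event (\<lambda>x. wait x r = enat n) \<in> sets M"
  using depends_upto_wait by (rule sets_event)

lemma event_True: "event (\<lambda>x. True) = space M"
  by (simp add: event_def)

lemma event_False: "event (\<lambda>x. False) = {}"
  by (simp add: event_def)

lemma prob_event_disj:
  assumes "depends_upto n A" and "depends_upto n B" and "\<And>x. A x \<Longrightarrow> \<not> B x"
  shows "prob (event (\<lambda>x. A x \<or> B x)) = prob (event A) + prob (event B)"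
proof -
  have "event (\<lambda>x. A x \<or> B x) = event A \<union> event B" and "event A \<inter> event B = {}"
    using assms(3) by (auto simp: event_def)
  then show ?thesis
    using assms(1,2) by (simp add: finite_measure_Union sets_event)
qed

lemma wait_prob_0: "wait_prob 0 n = of_bool (n = 0)"
  by (cases "n = 0") (simp_all add: wait_prob_def event_True event_False prob_space zero_enat_def)

lemma wait_prob_Suc_0: "wait_prob (Suc r) 0 = 0"
  by (simp add: wait_prob_def event_False waiting_time_Suc_neq_0)

lemma count_prob_0: "count_prob r 0 = of_bool (r = 0)"
  by (cases "r = 0") (simp_all add: count_prob_def event_True event_False prob_space)

text \<open>Balance of flow through the state \<open>r\<close>: count \<open>r\<close> at
  \<open>Suc n\<close> means having stayed or just arrived, count \<open>r\<close> at
  \<open>n\<close> means staying or leaving. The probability of staying cancels.\<close>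

lemma count_prob_Suc:
  "count_prob r (Suc n) + wait_prob (Suc r) (Suc n) = count_prob r n + wait_prob r (Suc n)"
proof -
  let ?C = "\<lambda>x. completes l1 l2 k2 x (Suc n)"
  \<comment> \<open>\<open>A\<close> is the event of staying: the count is \<open>r\<close> at time
    \<open>n\<close> and trial \<open>Suc n\<close> completes nothing.\<close>
  define A where "A = (\<lambda>x. count x n = r \<and> \<not> ?C x)"
  have A: "depends_upto (Suc n) A"
    unfolding A_def
    by (intro depends_upto_conj depends_upto_not depends_upto_completes depends_upto_count) simp
  have "(count x (Suc n) = r) = (A x \<or> wait x r = enat (Suc n))" for x
    by (cases r) (auto simp: A_def pattern_count_Suc[OF l1_pos] waiting_time_Suc_eq_iff[OF l1_pos])
  then have "count_prob r (Suc n) = prob (event (\<lambda>x. A x \<or> wait x r = enat (Suc n)))"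
    by (simp add: count_prob_def)
  also have "\<dots> = prob (event A) + wait_prob r (Suc n)"
    unfolding wait_prob_def
    by (rule prob_event_disj[OF A depends_upto_wait])
       (cases r; auto simp: A_def waiting_time_Suc_eq_iff[OF l1_pos])
  finally have 1: "count_prob r (Suc n) = prob (event A) + wait_prob r (Suc n)" .
  have "(count x n = r) = (A x \<or> wait x (Suc r) = enat (Suc n))" for x
    by (auto simp: A_def waiting_time_Suc_eq_iff[OF l1_pos])
  then have "count_prob r n = prob (event (\<lambda>x. A x \<or> wait x (Suc r) = enat (Suc n)))"
    by (simp add: count_prob_def)
  also have "\<dots> = prob (event A) + wait_prob (Suc r) (Suc n)"
    unfolding wait_prob_def
    by (rule prob_event_disj[OF A depends_upto_wait])
      (auto simp: A_def waiting_time_Suc_eq_iff[OF l1_pos])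
  finally show ?thesis
    using 1 by simp
qed

text \<open>The values 0 and 1 already carry the mass \<open>q + p = 1\<close>.\<close>

lemma AE_trial: "1 \<le> i \<Longrightarrow> AE \<omega> in M. \<zeta> i \<omega> = 0 \<or> \<zeta> i \<omega> = 1"
proof -
  assume i: "1 \<le> i"
  have dep: "depends_upto i (\<lambda>x. x i = c)" for c :: nat
    using i by (intro depends_upto_nth) auto
  have "prob (event (\<lambda>x. x i = 0 \<or> x i = 1)) = 1"
    using prob_event_disj[OF dep dep, of 0 1] prob_one[OF i] prob_zero[OF i] q_def by simp
  moreover have "event (\<lambda>x. x i = 0 \<or> x i = 1) \<in> sets M"
    using depends_upto_disj[OF dep dep] by (rule sets_event)
  ultimately have "AE \<omega> in M. \<omega> \<in> event (\<lambda>x. x i = 0 \<or> x i = 1)"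
    by (simp only: prob_eq_1)
  then show ?thesis
    by (rule eventually_mono) (simp add: event_def)
qed

text \<open>Split on the last trial. A one completes nothing, so in that case the count is the one
  at time \<open>n\<close>, which is independent of trial \<open>Suc n\<close>.\<close>

lemma count_prob_Suc_split: "count_prob r (Suc n) = count_zero_prob r (Suc n) + p * count_prob r n"
proof -
  let ?A = "\<lambda>x. count x (Suc n) = r \<and> 1 \<le> Suc n \<and> x (Suc n) = 0"
  let ?B = "\<lambda>x. count x n = r \<and> x (Suc n) = 1"
  have B: "?B x = (count x (Suc n) = r \<and> x (Suc n) = 1)" for x
    using not_completes_if_one[of x "Suc n"] by (auto simp: pattern_count_Suc[OF l1_pos])
  have dA: "depends_upto (Suc n) ?A"
    using depends_upto_conj[OF depends_upto_count[of "Suc n" "Suc n" "\<lambda>k. k = r"]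
        depends_upto_nth[of "Suc n" "Suc n" "\<lambda>k. k = 0"]] by simp
  have dB: "depends_upto (Suc n) ?B"
    by (intro depends_upto_conj depends_upto_count depends_upto_nth) auto
  have "count_prob r (Suc n) = prob (event (\<lambda>x. ?A x \<or> ?B x))"
    unfolding count_prob_def
  proof (rule finite_measure_eq_AE)
    show "AE \<omega> in M. \<omega> \<in> event (\<lambda>x. count x (Suc n) = r) \<longleftrightarrow> \<omega> \<in> event (\<lambda>x. ?A x \<or> ?B x)"
      using AE_trial[of "Suc n", simplified] by eventually_elim (unfold B, auto simp: event_def)
    show "event (\<lambda>x. ?A x \<or> ?B x) \<in> sets M"
      using depends_upto_disj[OF dA dB] by (rule sets_event)
  qed (rule sets_event[OF depends_upto_count[OF order_refl]])
  also have "\<dots> = prob (event ?A) + prob (event ?B)"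
    by (rule prob_event_disj[OF dA dB]) auto
  also have "prob (event ?B) = count_prob r n * p"
    using prob_event_Suc[OF depends_upto_count[of n n "\<lambda>k. k = r"]] prob_one[of "Suc n"]
    by (simp add: count_prob_def)
  finally show ?thesis
    by (simp add: count_zero_prob_def)
qed

text \<open>The first zero is split off because it belongs to \<open>count_zero_prob\<close>; the
  rest is arranged as consecutive runs after position \<open>n\<close>, as
  \<open>prob_event_run\<close> expects.\<close>

lemma occurrence_eq_runs:
  "occurrence l1 l2 x n t \<longleftrightarrow>
    x n = 0 \<and> (\<forall>i<l1 - 1. x (Suc n + i) = 0) \<and> (\<forall>i<l2 + t. x (Suc (n + (l1 - 1)) + i) = 1) \<and>
      x (Suc (n + (l1 - 1) + (l2 + t))) = 0"
proof -
  obtain k where "l1 = Suc k"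
    using l1_pos by (cases l1) auto
  then show ?thesis
    by (auto simp: occurrence_def All_less_Suc2 add.assoc)
qed

text \<open>Given the count and the zero at \<open>n\<close>, there follow \<open>l1 - 1\<close>
  zeros, \<open>l2 + t\<close> ones and the final zero, all independent of the past. The final zero
  restores the exponent \<open>l1\<close> of \<open>q\<close>.\<close>

lemma prob_occurrence:
  assumes "1 \<le> n"
  shows "prob (event (\<lambda>x. count x n = r \<and> occurrence l1 l2 x n t)) =
    q ^ l1 * p ^ l2 * p ^ t * count_zero_prob r n"
proof -
  let ?A = "\<lambda>x. count x n = r \<and> 1 \<le> n \<and> x n = 0"
  have A: "depends_upto n ?A"
    using assms depends_upto_conj[OF depends_upto_count[of n n "\<lambda>k. k = r"]
        depends_upto_nth[of n n "\<lambda>k. k = 0"]] by simp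
  let ?B = "\<lambda>x. ?A x \<and> (\<forall>i<l1 - 1. x (Suc n + i) = 0)"
  let ?C = "\<lambda>x. ?B x \<and> (\<forall>i<l2 + t. x (Suc (n + (l1 - 1)) + i) = 1)"
  note B = depends_upto_run[OF A, of "l1 - 1" 0]
  note C = depends_upto_run[OF B, of "l2 + t" 1]
  have "prob (event ?B) = prob (event ?A) * q ^ (l1 - 1)"
    by (rule prob_event_run[OF A prob_zero])
  moreover have "prob (event ?C) = prob (event ?B) * p ^ (l2 + t)"
    by (rule prob_event_run[OF B prob_one])
  moreover have "prob (event (\<lambda>x. ?C x \<and> x (Suc (n + (l1 - 1) + (l2 + t))) = 0)) =
    prob (event ?C) * q"
    unfolding prob_event_Suc[OF C] by (subst prob_zero) simp_all
  moreover have "event (\<lambda>x. count x n = r \<and> occurrence l1 l2 x n t) =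
      event (\<lambda>x. ?C x \<and> x (Suc (n + (l1 - 1) + (l2 + t))) = 0)"
    unfolding occurrence_eq_runs using assms by simp
  ultimately have "prob (event (\<lambda>x. count x n = r \<and> occurrence l1 l2 x n t)) =
      count_zero_prob r n * q ^ (l1 - 1) * p ^ (l2 + t) * q"
    by (simp only: count_zero_prob_def)
  also have "\<dots> = q * q ^ (l1 - 1) * p ^ l2 * p ^ t * count_zero_prob r n"
    by (simp add: power_add)
  also have "q * q ^ (l1 - 1) = q ^ l1"
    using l1_pos by (cases l1) auto
  finally show ?thesis .
qed

text \<open>Split on the surplus \<open>t\<close> of the occurrence that ends at \<open>m\<close>,
  which starts at \<open>m - (l1 + l2 + t)\<close>. Different surpluses give disjoint events by
  \<open>occurrence_start_unique\<close>.\<close>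

lemma wait_prob_Suc:
  "wait_prob (Suc r) m =
    (\<Sum>t\<le>k2 - l2. if l1 + l2 + t \<le> m
       then q ^ l1 * p ^ l2 * p ^ t * count_zero_prob r (m - (l1 + l2 + t)) else 0)"
proof -
  \<comment> \<open>The inequality is strict so that the start is at least 1. The claimed sum also
    admits equality, where its term vanishes because \<open>count_zero_prob r 0 = 0\<close>.\<close>
  define T where "T = {t. t \<le> k2 - l2 \<and> l1 + l2 + t < m}"
  define E where "E t = event (\<lambda>x. count x (m - (l1 + l2 + t)) = r \<and>
    occurrence l1 l2 x (m - (l1 + l2 + t)) t)" for t
  have fin: "finite T"
    by (simp add: T_def)
  have iff: "(wait x (Suc r) = enat m) =
      (\<exists>t\<in>T. count x (m - (l1 + l2 + t)) = r \<and> occurrence l1 l2 x (m - (l1 + l2 + t)) t)" for x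
  proof (cases m)
    case 0
    then show ?thesis
      by (simp add: T_def waiting_time_Suc_neq_0)
  next
    case (Suc m')
    \<comment> \<open>The count is moved back from just before the end to the first zero, so that
      each event factors into past and future.\<close>
    have *: "count x m' = count x n" if "occurrence l1 l2 x n t" "n + t + l1 + l2 = m" for n t
      using pattern_count_before_occurrence[OF l1_pos l2_pos that(1)] that(2) Suc by simp
    have "(wait x (Suc r) = enat m) =
        (count x m' = r \<and> (\<exists>n\<ge>1. \<exists>t\<le>k2 - l2. n + t + l1 + l2 = m \<and> occurrence l1 l2 x n t))"
      unfolding Suc waiting_time_Suc_eq_iff[OF l1_pos] completes_def ..
    also have "\<dots> = (\<exists>n t. 1 \<le> n \<and> t \<le> k2 - l2 \<and> n + t + l1 + l2 = m \<and>
      count x n = r \<and> occurrence l1 l2 x n t)"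
      using * by metis
    also have "\<dots> = (\<exists>t\<in>T. count x (m - (l1 + l2 + t)) = r \<and>
      occurrence l1 l2 x (m - (l1 + l2 + t)) t)"
    proof safe
      fix n t assume "1 \<le> n" "t \<le> k2 - l2" "m = n + t + l1 + l2" "occurrence l1 l2 x n t"
        "r = count x n"
      moreover from this have "n + t + l1 + l2 - (l1 + l2 + t) = n" by simp
      ultimately show "\<exists>ta\<in>T. count x (n + t + l1 + l2 - (l1 + l2 + ta)) = count x n \<and>
          occurrence l1 l2 x (n + t + l1 + l2 - (l1 + l2 + ta)) ta"
        by (intro bexI[of _ t]) (auto simp: T_def)
    next
      fix t assume "t \<in> T" "occurrence l1 l2 x (m - (l1 + l2 + t)) t"
      then show "\<exists>n ta. 1 \<le> n \<and> ta \<le> k2 - l2 \<and> n + ta + l1 + l2 = m \<and>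
            count x n = count x (m - (l1 + l2 + t)) \<and> occurrence l1 l2 x n ta"
        by (intro exI[of _ "m - (l1 + l2 + t)"] exI[of _ t]) (auto simp: T_def)
    qed
    finally show ?thesis .
  qed
  have "event (\<lambda>x. wait x (Suc r) = enat m) = (\<Union>t\<in>T. E t)"
    unfolding iff by (auto simp: event_def E_def)
  moreover have "prob (\<Union>t\<in>T. E t) = (\<Sum>t\<in>T. prob (E t))"
  proof (rule finite_measure_finite_Union[OF fin])
    have "E t \<in> sets M" if "t \<in> T" for t
      unfolding E_def
    proof (rule sets_event, rule depends_upto_conj[of m])
      show "depends_upto m (\<lambda>x. occurrence l1 l2 x (m - (l1 + l2 + t)) t)"
        by (rule depends_uptoI, rule occurrence_cong) (use that in \<open>auto simp: T_def\<close>)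
    qed (rule depends_upto_count, simp)
    then show "E ` T \<subseteq> sets M"
      by auto
    show "disjoint_family_on E T"
      unfolding disjoint_family_on_def
    proof (intro ballI impI, rule ccontr)
      fix s t assume st: "s \<in> T" "t \<in> T" "s \<noteq> t" "E s \<inter> E t \<noteq> {}"
      then obtain x where "occurrence l1 l2 x (m - (l1 + l2 + s)) s"
        "occurrence l1 l2 x (m - (l1 + l2 + t)) t"
        unfolding E_def event_def by blast
      moreover have "m - (l1 + l2 + s) + s = m - (l1 + l2 + t) + t"
        using st(1,2) by (simp add: T_def)
      ultimately show False
        using occurrence_start_unique l1_pos st(3) by blast
    qed
  qed
  ultimately have "wait_prob (Suc r) m = (\<Sum>t\<in>T. prob (E t))"
    by (simp add: wait_prob_def)
  also have "\<dots> = (\<Sum>t\<in>T. q ^ l1 * p ^ l2 * p ^ t * count_zero_prob r (m - (l1 + l2 + t)))"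
    unfolding E_def by (intro sum.cong refl prob_occurrence) (auto simp: T_def)
  also have "\<dots> = (\<Sum>t\<le>k2 - l2. if l1 + l2 + t \<le> m
       then q ^ l1 * p ^ l2 * p ^ t * count_zero_prob r (m - (l1 + l2 + t)) else 0)"
  proof (rule sum.mono_neutral_cong_left)
    show "\<forall>t\<in>{..k2 - l2} - T. (if l1 + l2 + t \<le> m
       then q ^ l1 * p ^ l2 * p ^ t * count_zero_prob r (m - (l1 + l2 + t)) else 0) = 0"
      by (auto simp: T_def count_zero_prob_def event_False)
  qed (auto simp: T_def)
  finally show ?thesis .
qed

section \<open>Generating series and their functional equations\<close>

lemma wait_prob_nonneg: "0 \<le> wait_prob r n"
  by (simp add: wait_prob_def)

lemma summable_wait_prob: "summable (wait_prob r)"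
proof -
  have "disjoint_family (\<lambda>n. event (\<lambda>x. wait x r = enat n))"
    by (auto simp: disjoint_family_on_def event_def)
  from finite_measure_UNION[OF _ this] sets_wait
  show ?thesis
    by (auto simp: wait_prob_def[abs_def] sums_iff)
qed

text \<open>The field is left open: complex for the analysis on the disc, real for the
  recurrences.\<close>

definition gen_fps :: "(nat \<Rightarrow> real) \<Rightarrow> 'b::real_normed_field fps" where
  "gen_fps f = Abs_fps (\<lambda>n. of_real (f n))"

lemma gen_fps_nth [simp]: "fps_nth (gen_fps f) n = of_real (f n)"
  by (simp add: gen_fps_def)

definition a :: real where "a = q ^ l1 * p ^ l2"

abbreviation l :: nat where "l \<equiv> l1 + l2"

abbreviation m2 :: nat where "m2 \<equiv> Suc (k2 - l2)"

text \<open>\<open>numer_poly / denom_poly\<close> is the ratio of consecutive generating functions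
  from \<open>r = 1\<close> on.\<close>

definition numer_poly :: "'b::real_normed_field poly" where
  "numer_poly = monom (of_real a) l * (1 - monom (of_real (p ^ m2)) m2)"

definition denom_poly :: "'b::real_normed_field poly" where
  "denom_poly = [:1, -1:] + numer_poly"

text \<open>This is \<open>q X / (1 - p X)\<close> times \<open>numer_poly\<close>, a polynomial
  because the geometric sum divides out \<open>1 - p X\<close>; it is the inhomogeneous term for
  \<open>r = 1\<close>.\<close>

definition init_poly :: "'b::real_normed_field poly" where
  "init_poly = (\<Sum>t<m2. monom (of_real (q * a * p ^ t)) (l + 1 + t))"

abbreviation G :: "nat \<Rightarrow> 'b::real_normed_field fps" where
  "G r \<equiv> gen_fps (wait_prob r)"

lemma poly_numer: "poly numer_poly z = of_real a * z ^ l * (1 - (of_real p * z) ^ m2)"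
  by (simp add: numer_poly_def poly_monom power_mult_distrib del: power_Suc)

lemma poly_denom: "poly denom_poly z = 1 - z + poly numer_poly z"
  by (simp add: denom_poly_def)

lemma poly_init: "(1 - of_real p * z) * poly init_poly z = of_real q * z * poly numer_poly z"
proof -
  have "poly init_poly z = of_real q * z * of_real a * z ^ l * (\<Sum>t<m2. (of_real p * z) ^ t)"
    by (simp add: init_poly_def poly_sum poly_monom sum_distrib_left power_add power_mult_distrib
      mult_ac del: sum.lessThan_Suc)
  then have "(1 - of_real p * z) * poly init_poly z =
      of_real q * z * of_real a * z ^ l * ((1 - of_real p * z) * (\<Sum>t<m2. (of_real p * z) ^ t))"
    by (simp only: mult_ac)
  also have "(1 - of_real p * z) * (\<Sum>t<m2. (of_real p * z) ^ t) = 1 - (of_real p * z) ^ m2"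
    by (rule one_diff_power_eq[symmetric])
  finally show ?thesis
    by (simp only: poly_numer mult_ac)
qed

lemma fps_numer:
  "fps_of_poly numer_poly = fps_const (of_real a) * fps_X ^ l *
    (1 - (fps_const (of_real p) * fps_X) ^ m2)"
  by (simp add: numer_poly_def fps_of_poly_mult fps_of_poly_diff fps_of_poly_monom
    power_mult_distrib fps_const_power del: power_Suc)

lemma fps_denom: "fps_of_poly denom_poly = 1 - fps_X + fps_of_poly numer_poly"
  by (simp add: denom_poly_def fps_of_poly_add fps_of_poly_pCons)

lemma fps_init:
  "fps_of_poly init_poly = fps_const (of_real (q * a)) * fps_X ^ (l + 1) *
     (\<Sum>t<m2. (fps_const (of_real p) * fps_X) ^ t)"
  by (simp add: init_poly_def fps_of_poly_sum fps_of_poly_monom sum_distrib_left power_add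
      power_mult_distrib fps_const_power mult_ac flip: fps_const_mult del: sum.lessThan_Suc)

lemma G_0: "G 0 = 1"
  by (rule fps_ext) (simp add: wait_prob_0)

lemma fps_count_prob: "(1 - fps_X) * gen_fps (count_prob r) = G r - G (Suc r)"
proof (rule fps_ext)
  fix n
  show "fps_nth ((1 - fps_X) * gen_fps (count_prob r)) n = fps_nth (G r - G (Suc r)) n"
  proof (cases n)
    case 0
    then show ?thesis
      by (cases r) (simp_all add: count_prob_0 wait_prob_0 wait_prob_Suc_0)
  next
    case (Suc n')
    have "count_prob r (Suc n') - count_prob r n' = wait_prob r (Suc n') -
      wait_prob (Suc r) (Suc n')"
      using count_prob_Suc[of r n'] by simp
    then show ?thesis
      using Suc by (simp add: left_diff_distrib flip: of_real_diff)
  qed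
qed

text \<open>The correction for \<open>r = 0\<close> concerns the constant coefficient only:
  \<open>count_prob 0 0\<close> is 1, whereas \<open>count_zero_prob 0 0\<close> is 0.\<close>

lemma fps_count_zero_prob:
  "gen_fps (count_zero_prob r) =
     (1 - fps_const (of_real p) * fps_X) * gen_fps (count_prob r) - of_bool (r = 0)"
proof (rule fps_ext)
  fix n
  show "fps_nth (gen_fps (count_zero_prob r)) n = fps_nth ((1 - fps_const (of_real p) * fps_X) *
      gen_fps (count_prob r) - of_bool (r = 0)) n"
    by (cases n) (simp_all add: left_diff_distrib mult.assoc count_prob_0 count_zero_prob_def
      event_False count_prob_Suc_split)
qed

lemma G_Suc_count_zero:
  "G (Suc r) = fps_const (of_real a) * fps_X ^ l * (\<Sum>t<m2. (fps_const (of_real p) * fps_X) ^ t) *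
     gen_fps (count_zero_prob r)"
proof (rule fps_ext)
  fix n
  have *: "fps_const (of_real a) * fps_X ^ l * (\<Sum>t<m2. (fps_const (of_real p) * fps_X) ^ t) *
     gen_fps (count_zero_prob r) =
     (\<Sum>t<m2. fps_const (of_real (a * p ^ t)) * (fps_X ^ (l + t) * gen_fps (count_zero_prob r)))"
    by (simp add: sum_distrib_left sum_distrib_right power_add power_mult_distrib fps_const_power
      mult_ac flip: fps_const_mult del: sum.lessThan_Suc)
  show "fps_nth (G (Suc r)) n = fps_nth (fps_const (of_real a) * fps_X ^ l *
     (\<Sum>t<m2. (fps_const (of_real p) * fps_X) ^ t) * gen_fps (count_zero_prob r)) n"
    unfolding *
    by (auto simp: wait_prob_Suc a_def fps_sum_nth fps_X_power_mult_nth lessThan_Suc_atMost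
        simp del: sum.lessThan_Suc intro!: sum.cong)
qed

text \<open>Multiplying \<open>G 1 = C * S * ((1 - P) * V - 1)\<close> by \<open>1 - fps_X\<close>
  allows \<open>V\<close> to be eliminated. The terms free of \<open>G 1\<close> combine to
  \<open>(1 - P) - (1 - fps_X) = fps_X - P\<close>, which is \<open>q X\<close>.\<close>

lemma denom_mult_G_1: "fps_of_poly denom_poly * G 1 = fps_of_poly init_poly"
proof -
  define P :: "'b fps" where "P = fps_const (of_real p) * fps_X"
  define C :: "'b fps" where "C = fps_const (of_real a) * fps_X ^ l"
  define S :: "'b fps" where "S = (\<Sum>t<m2. P ^ t)"
  define V :: "'b fps" where "V = gen_fps (count_prob 0)"
  have S: "(1 - P) * S = 1 - P ^ m2"
    unfolding S_def by (rule one_diff_power_eq[symmetric])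
  have V: "(1 - fps_X) * V = 1 - G 1"
    using fps_count_prob[of 0, where 'b = 'b] by (simp add: V_def G_0)
  have G1: "G 1 = C * S * ((1 - P) * V - 1)"
    using G_Suc_count_zero[of 0, where 'b = 'b] fps_count_zero_prob[of 0, where 'b = 'b]
    by (simp add: C_def S_def P_def V_def)
  have N: "fps_of_poly numer_poly = C * (1 - P ^ m2)"
    by (simp add: fps_numer C_def P_def)
  have qX: "fps_const (of_real q) * fps_X = fps_X - P"
    by (simp add: P_def q_def left_diff_distrib flip: fps_const_sub)
  have I: "fps_of_poly init_poly = (fps_const (of_real q) * fps_X) * C * S"
    by (simp add: fps_init C_def S_def P_def mult_ac flip: fps_const_mult)
  have "(1 - fps_X) * G 1 = C * S * ((1 - P) * ((1 - fps_X) * V) - (1 - fps_X))"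
    by (subst G1) (simp add: algebra_simps)
  also have "\<dots> = (fps_X - P) * C * S - C * ((1 - P) * S) * G 1"
    unfolding V by (simp add: algebra_simps)
  finally show ?thesis
    unfolding fps_denom N I qX S by (simp add: algebra_simps)
qed

text \<open>The same elimination; for \<open>r \<ge> 1\<close> the constant correction is absent and
  the equation is homogeneous.\<close>

lemma denom_mult_G_Suc:
  assumes "1 \<le> r"
  shows "fps_of_poly denom_poly * G (Suc r) = fps_of_poly numer_poly * G r"
proof -
  define P :: "'b fps" where "P = fps_const (of_real p) * fps_X"
  define C :: "'b fps" where "C = fps_const (of_real a) * fps_X ^ l"
  define S :: "'b fps" where "S = (\<Sum>t<m2. P ^ t)"
  define V :: "'b fps" where "V = gen_fps (count_prob r)"
  have S: "(1 - P) * S = 1 - P ^ m2"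
    unfolding S_def by (rule one_diff_power_eq[symmetric])
  have V: "(1 - fps_X) * V = G r - G (Suc r)"
    using fps_count_prob[of r] by (simp add: V_def)
  have G1: "G (Suc r) = C * S * ((1 - P) * V)"
    using assms unfolding G_Suc_count_zero fps_count_zero_prob
    by (simp add: C_def S_def P_def V_def)
  have N: "fps_of_poly numer_poly = C * (1 - P ^ m2)"
    by (simp add: fps_numer C_def P_def)
  have "(1 - fps_X) * G (Suc r) = C * ((1 - P) * S) * ((1 - fps_X) * V)"
    by (subst G1) (simp add: algebra_simps)
  then show ?thesis
    unfolding V S fps_denom N by (simp add: algebra_simps)
qed

section \<open>The generating function on the closed unit disc\<close>

lemma a_pos: "0 < a"
  unfolding a_def using p_pos p_less_1 q_def by (intro mult_pos_pos zero_less_power) auto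

definition gen_fun :: "nat \<Rightarrow> complex \<Rightarrow> complex" where
  "gen_fun r z = (\<Sum>n. of_real (wait_prob r n) * z ^ n)"

lemma sums_gen_fun:
  fixes z :: complex
  assumes "norm z \<le> 1"
  shows "(\<lambda>n. fps_nth (G r) n * z ^ n) sums gen_fun r z"
proof -
  have "summable (\<lambda>n. of_real (wait_prob r n) * z ^ n)"
    by (rule summable_comparison_test'[OF summable_wait_prob[of r], of 0])
       (use assms in \<open>auto simp: norm_mult norm_power wait_prob_nonneg intro!: mult_left_le
         power_le_one\<close>)
  then show ?thesis
    by (simp add: gen_fun_def summable_sums)
qed

text \<open>The formal identity is evaluated at \<open>z\<close>, before any division: it is from
  this product form that the denominator is shown to be nonzero.\<close>

lemma denom_mult_gen_fun_1:
  assumes "norm z \<le> 1"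
  shows "poly denom_poly z * gen_fun 1 z = poly init_poly z"
proof -
  \<comment> \<open>The right-hand side is evaluated as the product of \<open>init_poly\<close> with
    the constant series 1.\<close>
  have "(\<lambda>n. fps_nth (1 :: complex fps) n * z ^ n) sums 1"
    using sums_single[of 0 "\<lambda>_. 1 :: complex"] by (rule sums_cong[THEN iffD1, rotated]) auto
  from sums_fps_of_poly_mult[OF this, of init_poly]
  have "(\<lambda>n. fps_nth (fps_of_poly init_poly) n * z ^ n) sums poly init_poly z"
    by simp
  moreover have "(\<lambda>n. fps_nth (fps_of_poly init_poly) n * z ^ n) sums (poly denom_poly z *
    gen_fun 1 z)"
    using sums_fps_of_poly_mult[OF sums_gen_fun[OF assms, of 1], of denom_poly]
    unfolding denom_mult_G_1 .
  ultimately show ?thesis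
    by (rule sums_unique2[symmetric])
qed

lemma denom_mult_gen_fun_Suc:
  assumes "norm z \<le> 1" and "1 \<le> r"
  shows "poly denom_poly z * gen_fun (Suc r) z = poly numer_poly z * gen_fun r z"
proof -
  have "(\<lambda>n. fps_nth (fps_of_poly numer_poly * G r) n * z ^ n) sums (poly denom_poly z *
    gen_fun (Suc r) z)"
    using sums_fps_of_poly_mult[OF sums_gen_fun[OF assms(1), of "Suc r"], of denom_poly]
    unfolding denom_mult_G_Suc[OF assms(2)] .
  moreover have "(\<lambda>n. fps_nth (fps_of_poly numer_poly * G r) n * z ^ n) sums (poly numer_poly z *
    gen_fun r z)"
    using sums_fps_of_poly_mult[OF sums_gen_fun[OF assms(1), of r], of numer_poly] .
  ultimately show ?thesis
    by (rule sums_unique2)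
qed

lemma norm_p_mult_less_1:
  fixes z :: complex
  assumes "norm z \<le> 1"
  shows "norm (of_real p * z) < 1"
proof -
  have "p * norm z \<le> p"
    using assms p_pos by (intro mult_left_le) auto
  moreover have "norm (of_real p * z) = p * norm z"
    using p_pos by (simp add: norm_mult)
  ultimately show ?thesis
    using p_less_1 by linarith
qed

text \<open>The input is probabilistic: \<open>gen_fun 1\<close> is finite on the closed disc, so a
  zero of the denominator is a zero of \<open>init_poly\<close>. By \<open>poly_init\<close> and
  \<open>norm (p z) < 1\<close> only \<open>z = 0\<close> remains, where the denominator is
  1.\<close>

lemma denom_nonzero:
  fixes z :: complex
  assumes "norm z \<le> 1"
  shows "poly denom_poly z \<noteq> 0"
proof
  assume D: "poly denom_poly z = 0"
  then have "poly init_poly z = 0"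
    using denom_mult_gen_fun_1[OF assms] by simp
  then have "of_real q * z * poly numer_poly z = 0"
    using poly_init[of z] by simp
  then have "z = 0 \<or> poly numer_poly z = 0"
    using p_less_1 by (simp add: q_def)
  moreover have "(of_real p * z) ^ m2 \<noteq> 1"
    using norm_p_mult_less_1[OF assms]
    by (metis norm_one norm_power power_less_one_iff less_irrefl norm_ge_zero zero_less_Suc)
  ultimately have "z = 0"
    using a_pos l1_pos by (auto simp: poly_numer simp del: power_Suc)
  then show False
    using D l1_pos by (simp add: poly_denom poly_numer power_0_left)
qed

lemma gen_fun_eq:
  assumes "norm z \<le> 1" and "1 \<le> r"
  shows "gen_fun r z = of_real q * z / (1 - of_real p * z) *
    (poly numer_poly z / poly denom_poly z) ^ r"
  using assms(2)
proof (induction r rule: dec_induct)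
  case base
  have "1 - of_real p * z \<noteq> 0"
    using norm_p_mult_less_1[OF assms(1)] by auto
  then have *: "poly init_poly z = of_real q * z / (1 - of_real p * z) * poly numer_poly z"
    using poly_init[of z] by (simp add: field_simps)
  have "gen_fun 1 z = poly init_poly z / poly denom_poly z"
    using denom_mult_gen_fun_1[OF assms(1)] denom_nonzero[OF assms(1)]
    by (simp add: eq_divide_eq mult.commute)
  then show ?case
    by (simp only: * power_one_right times_divide_eq_right)
next
  case (step r)
  have "gen_fun (Suc r) z = poly numer_poly z / poly denom_poly z * gen_fun r z"
    using denom_mult_gen_fun_Suc[OF assms(1) step(1)] denom_nonzero[OF assms(1)]
    by (simp add: eq_divide_eq mult.commute)
  then show ?case
    unfolding step.IH by (simp only: power_Suc mult_ac)
qed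

lemma gen_fun_0: "gen_fun 0 z = 1"
proof -
  have "(\<lambda>n. of_real (wait_prob 0 n) * z ^ n) = (\<lambda>n. if n = 0 then 1 else 0)"
    by (auto simp: wait_prob_0)
  then show ?thesis
    using sums_single[of 0 "\<lambda>_. 1 :: complex"] by (simp add: gen_fun_def sums_iff)
qed

text \<open>At 1 the summand \<open>1 - z\<close> of the denominator vanishes, so numerator and
  denominator agree; they are nonzero as \<open>a > 0\<close> and \<open>p ^ m2 < 1\<close>. The
  prefactor is \<open>q / (1 - p) = 1\<close>.\<close>

lemma gen_fun_at_1: "gen_fun r 1 = 1"
proof (cases "r = 0")
  case False
  then have "1 \<le> r"
    by simp
  have "poly numer_poly (1 :: complex) = of_real (a * (1 - p ^ m2))"
    by (simp add: poly_numer del: power_Suc)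
  moreover have "p ^ m2 < 1"
    using p_pos p_less_1 by (intro power_Suc_less_one) auto
  ultimately have "poly numer_poly (1 :: complex) \<noteq> 0"
    using a_pos by (simp del: power_Suc of_real_power of_real_mult of_real_diff)
  moreover have "(of_real q :: complex) = 1 - of_real p" "of_real p \<noteq> (1 :: complex)"
    using p_less_1 by (auto simp: q_def)
  ultimately show ?thesis
    using gen_fun_eq[of 1 r] \<open>1 \<le> r\<close> by (simp add: poly_denom)
qed (simp add: gen_fun_0)

text \<open>This is the almost sure finiteness of the waiting times.\<close>

lemma sums_wait_prob: "wait_prob r sums 1"
proof -
  have "(\<lambda>n. of_real (wait_prob r n) :: complex) sums of_real 1"
    using sums_gen_fun[of 1 r] gen_fun_at_1[of r] by simp
  then show ?thesis
    by (simp only: sums_of_real_iff)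
qed

section \<open>Convergence beyond the unit circle and finite moments\<close>

lemma fps_conv_radius_G: "1 < fps_conv_radius (G r :: complex fps)"
proof -
  obtain R where R: "1 < R" "\<And>z. norm z < R \<Longrightarrow> poly denom_poly z \<noteq> (0 :: complex)"
    using poly_nonzero_on_larger_disc[OF denom_nonzero] by blast
  let ?D = "fps_of_poly denom_poly :: complex fps"
  have "fps_nth ?D 0 \<noteq> 0"
    using denom_nonzero[of 0] by (simp add: poly_0_coeff_0)
  \<comment> \<open>The constant coefficient of the denominator is nonzero, so it is invertible as a
    formal series and bounds on \<open>?D * F\<close> carry over to \<open>F\<close>.\<close>
  then have D: "F = inverse ?D * (?D * F)" for F
    by (simp add: inverse_mult_eq_1 flip: mult.assoc)
  have inv: "ereal R \<le> fps_conv_radius (inverse ?D)"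
    using R(2) by (rule fps_conv_radius_inverse_poly)
  \<comment> \<open>The same radius \<open>R\<close> serves for all \<open>r\<close>, since every
    step divides by the same denominator.\<close>
  have "ereal R \<le> fps_conv_radius (G r :: complex fps)"
  proof (induction r)
    case 0
    then show ?case
      by (simp add: G_0)
  next
    case (Suc r)
    have "ereal R \<le> fps_conv_radius (?D * G (Suc r))"
    proof (cases "r = 0")
      case True
      then show ?thesis
        using denom_mult_G_1[where 'b = complex] by simp
    next
      case False
      then show ?thesis
        using Suc.IH denom_mult_G_Suc[of r, where 'b = complex]
        by (simp add: fps_conv_radius_mult_ge)
    qed
    with inv show ?case
      by (subst D) (rule fps_conv_radius_mult_ge)
  qed
  moreover have "1 < ereal R"
    using R(1) by (simp add: one_ereal_def)
  ultimately show ?thesis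
    by (rule less_le_trans[rotated])
qed

lemma summable_wait_moment: "summable (\<lambda>n. real n ^ j * wait_prob r n)"
proof -
  have "norm (of_nat n ^ j * fps_nth (G r) n :: complex) = real n ^ j * wait_prob r n" for n
    by (simp add: norm_mult norm_power wait_prob_nonneg)
  then show ?thesis
    using summable_moments_fps[OF fps_conv_radius_G, of j r] by simp
qed

definition wait_moment :: "nat \<Rightarrow> nat \<Rightarrow> real" where
  "wait_moment r j = (\<Sum>n. real n ^ j * wait_prob r n)"

lemma sums_wait_moment: "(\<lambda>n. real n ^ j * fps_nth (G r) n) sums wait_moment r j"
  using summable_wait_moment[of j r] by (simp add: wait_moment_def summable_sums)

lemma wait_moment_nonneg: "0 \<le> wait_moment r j"
  unfolding wait_moment_def
  by (intro suminf_nonneg summable_wait_moment) (simp add: wait_prob_nonneg)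

lemma wait_moment_0: "wait_moment 0 j = of_bool (j = 0)"
proof -
  have "(\<lambda>n. real n ^ j * wait_prob 0 n) = (\<lambda>n. if n = 0 then of_bool (j = 0) else 0)"
    by (auto simp: wait_prob_0)
  then show ?thesis
    using sums_single[of 0 "\<lambda>_. of_bool (j = 0) :: real"] by (simp add: wait_moment_def sums_iff)
qed

section \<open>Recurrences for the moments\<close>

lemma fps_numer_mult:
  "fps_of_poly numer_poly * F = fps_const (of_real a) * (fps_X ^ l * F) -
    fps_const (of_real (a * p ^ m2)) * (fps_X ^ (l + m2) * F)"
proof -
  have "fps_const (of_real a) * fps_X ^ l * (1 - (fps_const (of_real p) * fps_X) ^ m) * F =
    fps_const (of_real a) * (fps_X ^ l * F) -
    fps_const (of_real (a * p ^ m)) * (fps_X ^ (l + m) * F)" for m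
    by (simp add: algebra_simps power_add power_mult_distrib fps_const_power flip: fps_const_mult)
  then show ?thesis
    unfolding fps_numer .
qed

text \<open>The functional equation as a combination of shifts. Comparing coefficients gives the
  recurrence of the mass function, summing against \<open>n ^ j\<close> that of the moments.\<close>

lemma G_Suc_eq:
  assumes "1 \<le> r"
  shows "(G (Suc r) :: 'b::real_normed_field fps) = fps_X ^ 1 * G (Suc r) +
    (fps_const (of_real a) * (fps_X ^ l * (G r - G (Suc r))) -
    fps_const (of_real (a * p ^ m2)) * (fps_X ^ (l + m2) * (G r - G (Suc r))))"
proof -
  have "(G (Suc r) :: 'b fps) = fps_X ^ 1 * G (Suc r) + fps_of_poly numer_poly * (G r - G (Suc r))"
    using denom_mult_G_Suc[OF assms, where 'b = 'b] unfolding fps_denom by (simp add: algebra_simps)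
  then show ?thesis
    unfolding fps_numer_mult .
qed

lemma G_1_eq:
  "(G 1 :: 'b::real_normed_field fps) = fps_X ^ 1 * G 1 -
    (fps_const (of_real a) * (fps_X ^ l * G 1) -
    fps_const (of_real (a * p ^ m2)) * (fps_X ^ (l + m2) * G 1)) + fps_of_poly init_poly"
proof -
  have "(G 1 :: 'b fps) = fps_X ^ 1 * G 1 - fps_of_poly numer_poly * G 1 + fps_of_poly init_poly"
    using denom_mult_G_1[where 'b = 'b] unfolding fps_denom by (simp add: algebra_simps)
  then show ?thesis
    unfolding fps_numer_mult .
qed

lemma init_nth:
  "fps_nth (fps_of_poly init_poly) n =
    (if n \<in> {l + 1..l + m2} then of_real (q * a * p ^ (n - l - 1)) else 0)"
proof -
  have "fps_nth (fps_of_poly init_poly) n =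
      (\<Sum>t<m2. if t = n - l - 1 then if l + 1 \<le> n then of_real (q * a * p ^ t) else 0 else 0)"
    unfolding init_poly_def fps_of_poly_nth coeff_sum by (intro sum.cong refl) auto
  also have "\<dots> = (if n \<in> {l + 1..l + m2} then of_real (q * a * p ^ (n - l - 1)) else 0)"
    by (subst sum.delta) auto
  finally show ?thesis .
qed

text \<open>\<open>G_Suc_eq\<close> is summed against \<open>n ^ j\<close>, with shifts 1,
  \<open>l\<close> and \<open>l + m2\<close> expanded binomially. The formula is implicit: the
  summand \<open>k = j\<close> contains \<open>wait_moment (Suc r) j\<close>, and after cancellation
  this moment keeps the nonzero coefficient \<open>- a * (1 - p ^ m2)\<close> on the right.\<close>

lemma wait_moment_Suc:
  assumes "1 \<le> r"
  shows "wait_moment (Suc r) j = (\<Sum>k\<le>j. real (j choose k) *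
    (wait_moment (Suc r) k + a * (real l ^ (j - k) - p ^ m2 * real (l + m2) ^ (j - k)) *
      (wait_moment r k - wait_moment (Suc r) k)))"
proof -
  let ?\<mu> = "wait_moment"
  let ?w = "\<lambda>F n. real n ^ j * fps_nth F n"
  let ?D = "G r - G (Suc r)"
  have diff: "(\<lambda>n. real n ^ k * fps_nth ?D n) sums (?\<mu> r k - ?\<mu> (Suc r) k)" for k
    using sums_diff[OF sums_wait_moment[of k r] sums_wait_moment[of k "Suc r"]]
    by (simp add: algebra_simps)
  have shift: "?w (fps_X ^ i * ?D) sums
      (\<Sum>k\<le>j. real (j choose k) * real i ^ (j - k) * (?\<mu> r k - ?\<mu> (Suc r) k))" for i
    by (rule sums_moment_shift) (rule diff)
  have first: "?w (fps_X ^ 1 * G (Suc r)) sums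
      (\<Sum>k\<le>j. real (j choose k) * real 1 ^ (j - k) * ?\<mu> (Suc r) k)"
    by (rule sums_moment_shift) (rule sums_wait_moment)
  have eq: "?w (G (Suc r)) n = ?w (fps_X ^ 1 * G (Suc r)) n +
      (a * ?w (fps_X ^ l * ?D) n - a * p ^ m2 * ?w (fps_X ^ (l + m2) * ?D) n)" for n
  proof -
    have "fps_nth (G (Suc r)) n = fps_nth (fps_X ^ 1 * G (Suc r)) n +
      (a * fps_nth (fps_X ^ l * ?D) n - a * p ^ m2 * fps_nth (fps_X ^ (l + m2) * ?D) n)"
      using arg_cong[OF G_Suc_eq[OF assms, where 'b = real], of "\<lambda>F. fps_nth F n"]
      by (simp only: fps_add_nth fps_sub_nth fps_mult_left_const_nth of_real_eq_id id_apply)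
    then show ?thesis
      by (simp only: distrib_left right_diff_distrib mult.left_commute)
  qed
  from sums_add[OF first sums_diff[OF sums_mult[OF shift[of l], of a]
      sums_mult[OF shift[of "l + m2"], of "a * p ^ m2"]]]
  have "?w (G (Suc r)) sums ((\<Sum>k\<le>j. real (j choose k) * real 1 ^ (j - k) * ?\<mu> (Suc r) k) +
     (a * (\<Sum>k\<le>j. real (j choose k) * real l ^ (j - k) * (?\<mu> r k - ?\<mu> (Suc r) k)) -
      a * p ^ m2 * (\<Sum>k\<le>j. real (j choose k) * real (l + m2) ^ (j - k) * (?\<mu> r k - ?\<mu> (Suc r) k))))"
    by (simp only: eq)
  with sums_wait_moment[of j "Suc r"]
  have "?\<mu> (Suc r) j = (\<Sum>k\<le>j. real (j choose k) * real 1 ^ (j - k) * ?\<mu> (Suc r) k) +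
     (a * (\<Sum>k\<le>j. real (j choose k) * real l ^ (j - k) * (?\<mu> r k - ?\<mu> (Suc r) k)) -
      a * p ^ m2 * (\<Sum>k\<le>j. real (j choose k) * real (l + m2) ^ (j - k) * (?\<mu> r k - ?\<mu> (Suc r) k)))"
    by (rule sums_unique2)
  also have "\<dots> = (\<Sum>k\<le>j. real (j choose k) *
    (?\<mu> (Suc r) k + a * (real l ^ (j - k) - p ^ m2 * real (l + m2) ^ (j - k)) *
      (?\<mu> r k - ?\<mu> (Suc r) k)))"
    unfolding sum_distrib_left sum_subtractf[symmetric] sum.distrib[symmetric]
    by (intro sum.cong refl) (simp add: algebra_simps)
  finally show ?thesis .
qed

text \<open>As for larger \<open>r\<close>, with \<open>init_poly\<close> contributing the finite
  sum over its exponents \<open>l + 1\<close> to \<open>l + m2\<close>.\<close>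

lemma wait_moment_1:
  "wait_moment 1 j = (\<Sum>k\<le>j. real (j choose k) * wait_moment 1 k *
      (1 - a * (real l ^ (j - k) - p ^ m2 * real (l + m2) ^ (j - k)))) +
    q * a * (\<Sum>k = l + 1..l + m2. real k ^ j * p ^ (k - l - 1))"
proof -
  let ?\<mu> = "wait_moment 1"
  let ?w = "\<lambda>F n. real n ^ j * fps_nth F n"
  let ?I = "q * a * (\<Sum>k = l + 1..l + m2. real k ^ j * p ^ (k - l - 1))"
  have shift: "?w (fps_X ^ i * G 1) sums (\<Sum>k\<le>j. real (j choose k) * real i ^ (j - k) * ?\<mu> k)" for i
    by (rule sums_moment_shift) (rule sums_wait_moment)
  have "?w (fps_of_poly init_poly) sums
      (\<Sum>k\<in>{l + 1..l + m2}. q * a * (real k ^ j * p ^ (k - l - 1)))"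
    using sums_If_finite_set[of "{l + 1..l + m2}" "\<lambda>k. q * a * (real k ^ j * p ^ (k - l - 1))"]
    by (rule sums_cong[THEN iffD1, rotated]) (auto simp: init_nth mult_ac simp del: fps_of_poly_nth)
  then have init: "?w (fps_of_poly init_poly) sums ?I"
    by (simp only: sum_distrib_left)
  have eq: "?w (G 1) n = ?w (fps_X ^ 1 * G 1) n -
      (a * ?w (fps_X ^ l * G 1) n - a * p ^ m2 * ?w (fps_X ^ (l + m2) * G 1) n) +
      ?w (fps_of_poly init_poly) n" for n
  proof -
    have "fps_nth (G 1) n = fps_nth (fps_X ^ 1 * G 1) n -
      (a * fps_nth (fps_X ^ l * G 1) n - a * p ^ m2 * fps_nth (fps_X ^ (l + m2) * G 1) n) +
      fps_nth (fps_of_poly init_poly) n"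
      using arg_cong[OF G_1_eq[where 'b = real], of "\<lambda>F. fps_nth F n"]
      by (simp only: fps_add_nth fps_sub_nth fps_mult_left_const_nth of_real_eq_id id_apply)
    then show ?thesis
      by (simp only: distrib_left right_diff_distrib mult.left_commute)
  qed
  from sums_add[OF sums_diff[OF shift[of 1] sums_diff[OF sums_mult[OF shift[of l], of a]
      sums_mult[OF shift[of "l + m2"], of "a * p ^ m2"]]] init]
  have "?w (G 1) sums ((\<Sum>k\<le>j. real (j choose k) * real 1 ^ (j - k) * ?\<mu> k) -
     (a * (\<Sum>k\<le>j. real (j choose k) * real l ^ (j - k) * ?\<mu> k) -
      a * p ^ m2 * (\<Sum>k\<le>j. real (j choose k) * real (l + m2) ^ (j - k) * ?\<mu> k)) + ?I)"
    by (simp only: eq)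
  with sums_wait_moment[of j 1]
  have "?\<mu> j = (\<Sum>k\<le>j. real (j choose k) * real 1 ^ (j - k) * ?\<mu> k) -
     (a * (\<Sum>k\<le>j. real (j choose k) * real l ^ (j - k) * ?\<mu> k) -
      a * p ^ m2 * (\<Sum>k\<le>j. real (j choose k) * real (l + m2) ^ (j - k) * ?\<mu> k)) + ?I"
    by (rule sums_unique2)
  also have "(\<Sum>k\<le>j. real (j choose k) * real 1 ^ (j - k) * ?\<mu> k) -
     (a * (\<Sum>k\<le>j. real (j choose k) * real l ^ (j - k) * ?\<mu> k) -
      a * p ^ m2 * (\<Sum>k\<le>j. real (j choose k) * real (l + m2) ^ (j - k) * ?\<mu> k)) =
    (\<Sum>k\<le>j. real (j choose k) * ?\<mu> k *
      (1 - a * (real l ^ (j - k) - p ^ m2 * real (l + m2) ^ (j - k))))"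
    unfolding sum_distrib_left sum_subtractf[symmetric]
    by (intro sum.cong refl) (simp add: algebra_simps)
  finally show ?thesis .
qed

section \<open>The mass function on the integers\<close>

definition wait_prob_int :: "nat \<Rightarrow> int \<Rightarrow> real" where
  "wait_prob_int r m = (if m < 0 then 0 else wait_prob r (nat m))"

text \<open>For \<open>m < k\<close> the vanishing coefficient on the left matches the value 0 at
  negative arguments, so the recurrences require no case distinction.\<close>

lemma fps_X_power_mult_G_nth:
  "0 \<le> m \<Longrightarrow> fps_nth (fps_X ^ k * G r) (nat m) = wait_prob_int r (m - int k)"
  by (auto simp: wait_prob_int_def fps_X_power_mult_nth nat_diff_distrib)

lemma wait_prob_int_Suc:
  assumes "1 \<le> r" and "0 \<le> m"
  shows "wait_prob_int (Suc r) m = wait_prob_int (Suc r) (m - 1) +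
    a * (wait_prob_int r (m - int l) - wait_prob_int (Suc r) (m - int l) -
      p ^ m2 * (wait_prob_int r (m - int l - int m2) - wait_prob_int (Suc r) (m - int l - int m2)))"
proof -
  have "wait_prob_int (Suc r) m = fps_nth (G (Suc r)) (nat m)"
    using assms(2) by (simp add: wait_prob_int_def)
  also have "\<dots> = fps_nth (fps_X ^ 1 * G (Suc r)) (nat m) +
      (a * (fps_nth (fps_X ^ l * G r) (nat m) - fps_nth (fps_X ^ l * G (Suc r)) (nat m)) -
       a * p ^ m2 *
         (fps_nth (fps_X ^ (l + m2) * G r) (nat m) - fps_nth (fps_X ^ (l + m2) * G (Suc r)) (nat m)))"
    using arg_cong[OF G_Suc_eq[OF assms(1), where 'b = real], of "\<lambda>F. fps_nth F (nat m)"]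
    by (simp only: fps_add_nth fps_sub_nth fps_mult_left_const_nth right_diff_distrib
      of_real_eq_id id_apply)
  also have "\<dots> = wait_prob_int (Suc r) (m - 1) +
      (a * (wait_prob_int r (m - int l) - wait_prob_int (Suc r) (m - int l)) -
       a * p ^ m2 * (wait_prob_int r (m - int l - int m2) - wait_prob_int (Suc r) (m - int l - int m2)))"
    unfolding fps_X_power_mult_G_nth[OF assms(2)] by (simp only: of_nat_add of_nat_1 diff_diff_eq)
  finally show ?thesis
    by (simp only: right_diff_distrib mult.assoc add_diff_eq)
qed

lemma wait_prob_int_1:
  assumes "0 \<le> m"
  shows "wait_prob_int 1 m = wait_prob_int 1 (m - 1) -
    a * (wait_prob_int 1 (m - int l) - p ^ m2 * wait_prob_int 1 (m - int l - int m2)) +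
    (if int l + 1 \<le> m \<and> m \<le> int l + int m2 then q * a * p ^ nat (m - int l - 1) else 0)"
proof -
  have "wait_prob_int 1 m = fps_nth (G 1) (nat m)"
    using assms by (simp add: wait_prob_int_def)
  also have "\<dots> = fps_nth (fps_X ^ 1 * G 1) (nat m) -
      (a * fps_nth (fps_X ^ l * G 1) (nat m) - a * p ^ m2 * fps_nth (fps_X ^ (l + m2) * G 1) (nat m)) +
      fps_nth (fps_of_poly init_poly) (nat m)"
    using arg_cong[OF G_1_eq[where 'b = real], of "\<lambda>F. fps_nth F (nat m)"]
    by (simp only: fps_add_nth fps_sub_nth fps_mult_left_const_nth of_real_eq_id id_apply)
  also have "\<dots> = wait_prob_int 1 (m - 1) -
      (a * wait_prob_int 1 (m - int l) - a * p ^ m2 * wait_prob_int 1 (m - int l - int m2)) +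
      (if nat m \<in> {l + 1..l + m2} then q * a * p ^ (nat m - l - 1) else 0)"
    unfolding fps_X_power_mult_G_nth[OF assms] init_nth
    by (simp only: of_nat_add of_nat_1 diff_diff_eq of_real_eq_id id_apply)
  also have "nat m \<in> {l + 1..l + m2} \<longleftrightarrow> int l + 1 \<le> m \<and> m \<le> int l + int m2"
    using assms by auto
  also have "nat m - l - 1 = nat (m - int l - 1)"
    using assms by simp
  finally show ?thesis
    by (simp only: right_diff_distrib mult.assoc)
qed

text \<open>The recurrences hold for all \<open>m \<ge> 0\<close>, so the zero range follows by
  induction on \<open>r\<close> and, inside, on \<open>m\<close>: from
  \<open>m \<le> l * Suc r\<close> the arguments shifted by \<open>l\<close> satisfy the bound for
  \<open>r\<close>. In the base case the inhomogeneous term starts only at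
  \<open>l + 1\<close>.\<close>

lemma wait_prob_int_eq_0:
  assumes "1 \<le> r" and "m \<le> int l * int r"
  shows "wait_prob_int r m = 0"
  using assms
proof (induction r arbitrary: m rule: dec_induct)
  case base
  then show ?case
  \<comment> \<open>Adding 1 makes the measure of \<open>m = 0\<close> strictly larger than that of
    negative arguments.\<close>
  proof (induction "nat (m + 1)" arbitrary: m rule: less_induct)
    case (less m)
    show ?case
    proof (cases "m < 0")
      case False
      have "wait_prob_int 1 k = 0" if "k < m" for k
        using that False less by (intro less.hyps) auto
      then show ?thesis
        using False less.prems l1_pos wait_prob_int_1[of m] by simp
    qed (simp add: wait_prob_int_def)
  qed
next
  case (step r)
  show ?case
    using step.prems
  proof (induction "nat (m + 1)" arbitrary: m rule: less_induct)
    case (less m)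
    show ?case
    proof (cases "m < 0")
      case False
      have "wait_prob_int (Suc r) k = 0" if "k < m" for k
        using that False less by (intro less.hyps) auto
      moreover have "wait_prob_int r k = 0" if "k \<le> m - int l" for k
        using that less.prems by (intro step.IH) (auto simp: algebra_simps)
      ultimately show ?thesis
        using False l1_pos wait_prob_int_Suc[OF step(1), of m] by simp
    qed (simp add: wait_prob_int_def)
  qed
qed

end

section \<open>Generating function, mass function and moments of the random waiting times\<close>

theorem theorem2p6:
  fixes M :: "'a measure" and \<zeta> :: "nat \<Rightarrow> 'a \<Rightarrow> nat"
    and p q a :: real and l1 l2 k2 l m2 :: nat
    and \<rho> :: "nat \<Rightarrow> 'a \<Rightarrow> enat"
    and H :: "nat \<Rightarrow> complex \<Rightarrow> complex"
    and g :: "nat \<Rightarrow> int \<Rightarrow> real"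
    and \<mu> :: "nat \<Rightarrow> nat \<Rightarrow> real"
  assumes "prob_space M"
    and "prob_space.indep_vars M (\<lambda>_. count_space UNIV) \<zeta> {1..}"
    and "\<And>i. i \<ge> 1 \<Longrightarrow> measure M {\<omega> \<in> space M. \<zeta> i \<omega> = 1} = p"
    and "\<And>i. i \<ge> 1 \<Longrightarrow> measure M {\<omega> \<in> space M. \<zeta> i \<omega> = 0} = q"
    and "0 < p" and "p < 1" and "q = 1 - p"
    and "1 \<le> l1" and "1 \<le> l2" and "l2 \<le> k2"
    and "a = q ^ l1 * p ^ l2" and "l = l1 + l2" and "m2 = k2 - l2 + 1"
    and "\<And>r \<omega>. \<rho> r \<omega> = waiting_time l1 l2 k2 (\<lambda>i. \<zeta> i \<omega>) r"
    and "\<And>r t. H r t = prob_gen_fun M (\<rho> r) t"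
    and "\<And>r m. g r m = prob_mass_fun M (\<rho> r) m"
    and "\<And>r j. \<mu> r j = enn2real (moment M (\<rho> r) j)"
  shows
    "(\<forall>r\<ge>1. \<forall>t. norm t \<le> 1 \<longrightarrow>
        H r t = (of_real q * t / (1 - of_real p * t)) *
          ((of_real a * t ^ l * (1 - (of_real p * t) ^ m2)) /
           (1 - t + of_real a * t ^ l * (1 - (of_real p * t) ^ m2))) ^ r)
     \<and>
     (\<forall>r\<ge>2. \<forall>m\<ge>int l * int r + 1.
        g r m = g r (m - 1) +
          a * (g (r - 1) (m - int l) - g r (m - int l)
               - p ^ m2 * (g (r - 1) (m - int l - int m2) - g r (m - int l - int m2)))) \<and>
     (\<forall>m\<ge>int l + 1.
        g 1 m = g 1 (m - 1) - a * (g 1 (m - int l) - p ^ m2 * g 1 (m - int l - int m2))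
          + (if int l + 1 \<le> m \<and> m \<le> int l + int m2
             then q * a * p ^ nat (m - int l - 1) else 0)) \<and>
     (\<forall>m. g 0 m = (if m = 0 then 1 else 0)) \<and>
     (\<forall>r\<ge>1. \<forall>m\<le>int l * int r. g r m = 0)
     \<and>
     (\<forall>r j. moment M (\<rho> r) j < \<infinity>) \<and>
     (\<forall>j\<ge>1. \<forall>r\<ge>2.
        \<mu> r j = (\<Sum>k\<le>j. real (j choose k) *
          (\<mu> r k + a * (real l ^ (j - k) - p ^ m2 * real (l + m2) ^ (j - k))
                     * (\<mu> (r - 1) k - \<mu> r k)))) \<and>
     (\<forall>i. \<mu> 0 i = (if i = 0 then 1 else 0)) \<and>
     (\<forall>j\<ge>1.
        \<mu> 1 j = (\<Sum>k\<le>j. real (j choose k) * \<mu> 1 k *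
            (1 - a * (real l ^ (j - k) - p ^ m2 * real (l + m2) ^ (j - k))))
          + q * a * (\<Sum>k=l+1..l+m2. real k ^ j * p ^ (k - l - 1)))"
proof -
  have event_eq: "nat_trials.event M \<zeta> A = {\<omega> \<in> space M. A (\<lambda>i. \<zeta> i \<omega>)}" for A
    using assms(1,2) by (simp add: nat_trials.event_def nat_trials_def nat_trials_axioms_def)
  interpret T: pattern_trials M \<zeta> p q l1 l2 k2
    using assms(1-9)
    by (simp add: pattern_trials_def pattern_trials_axioms_def nat_trials_def
      nat_trials_axioms_def event_eq)
  have a: "a = T.a" and m2: "m2 = Suc (k2 - l2)"
    using assms(11,13) by (simp_all add: T.a_def)
  have W: "{\<omega> \<in> space M. \<rho> r \<omega> = enat n} = T.event (\<lambda>x. waiting_time l1 l2 k2 x r = enat n)" for r n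
    using assms(14) by (simp add: event_eq)
  have W_prob: "measure M {\<omega> \<in> space M. \<rho> r \<omega> = enat n} = T.wait_prob r n" for r n
    by (simp add: W T.wait_prob_def)
  have W_sets: "{\<omega> \<in> space M. \<rho> r \<omega> = enat n} \<in> sets M" for r n
    unfolding W by (rule T.sets_wait)
  have H: "H r t = T.gen_fun r t" if "norm t \<le> 1" for r t
    unfolding assms(15) prob_gen_fun_eq_suminf[OF assms(1) W_sets that] W_prob T.gen_fun_def ..
  \<comment> \<open>The extended moment is the image of a real number, so it is finite and
    \<open>enn2real\<close> recovers that number.\<close>
  have moment: "moment M (\<rho> r) j = ennreal (T.wait_moment r j)" for r j
    using moment_eq_suminf[OF assms(1) W_sets, of r j]
    by (simp add: W_prob T.wait_moment_def T.sums_wait_prob T.summable_wait_moment)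
  have \<mu>: "\<mu> = T.wait_moment"
    by (intro ext) (simp add: assms(17) moment T.wait_moment_nonneg)
  have g: "g = T.wait_prob_int"
  proof (intro ext)
    fix r m
    show "g r m = T.wait_prob_int r m"
    proof (cases "m < 0")
      case True
      then show ?thesis
        by (auto simp: assms(16) prob_mass_fun_def T.wait_prob_int_def)
    next
      case False
      then have "(\<exists>n. \<rho> r \<omega> = enat n \<and> int n = m) \<longleftrightarrow> \<rho> r \<omega> = enat (nat m)" for \<omega>
        by auto
      with False show ?thesis
        by (simp add: assms(16) prob_mass_fun_def T.wait_prob_int_def W_prob)
    qed
  qed
  have "H r t = (of_real q * t / (1 - of_real p * t)) *
          ((of_real a * t ^ l * (1 - (of_real p * t) ^ m2)) /
           (1 - t + of_real a * t ^ l * (1 - (of_real p * t) ^ m2))) ^ r"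
    if "r \<ge> 1" "norm t \<le> 1" for r t
    unfolding H[OF that(2)] T.gen_fun_eq[OF that(2,1)] T.poly_denom T.poly_numer a assms(12) m2 ..
  moreover have "g r m = g r (m - 1) +
          a * (g (r - 1) (m - int l) - g r (m - int l)
               - p ^ m2 * (g (r - 1) (m - int l - int m2) - g r (m - int l - int m2)))"
    if "r \<ge> 2" "m \<ge> int l * int r + 1" for r m
  proof -
    \<comment> \<open>The bound on \<open>m\<close> puts it in the range where the coefficient
      identity can be read off.\<close>
    have "0 \<le> m"
      using that(2) by (rule order_trans[rotated]) simp
    then show ?thesis
      using T.wait_prob_int_Suc[of "r - 1" m] that(1)
      by (simp add: g a assms(12) m2 del: power_Suc of_nat_Suc of_nat_add)
  qed
  moreover have "g 1 m = g 1 (m - 1) - a * (g 1 (m - int l) - p ^ m2 * g 1 (m - int l - int m2))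
          + (if int l + 1 \<le> m \<and> m \<le> int l + int m2
             then q * a * p ^ nat (m - int l - 1) else 0)"
    if "m \<ge> int l + 1" for m
    unfolding g a assms(12) m2 by (rule T.wait_prob_int_1) (use that in simp)
  moreover have "g 0 m = (if m = 0 then 1 else 0)" for m
    by (auto simp: g T.wait_prob_int_def T.wait_prob_0)
  moreover have "g r m = 0" if "r \<ge> 1" "m \<le> int l * int r" for r m
    unfolding g by (rule T.wait_prob_int_eq_0) (use that assms(12) in simp_all)
  moreover have "moment M (\<rho> r) j < \<infinity>" for r j
    by (simp add: moment)
  moreover have "\<mu> r j = (\<Sum>k\<le>j. real (j choose k) *
          (\<mu> r k + a * (real l ^ (j - k) - p ^ m2 * real (l + m2) ^ (j - k))
                     * (\<mu> (r - 1) k - \<mu> r k)))" if "r \<ge> 2" for j r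
  proof -
    obtain s where s: "r = Suc s" "1 \<le> s"
      using \<open>r \<ge> 2\<close> by (cases r) auto
    show ?thesis
      unfolding \<mu> a assms(12) m2 s(1) diff_Suc_1 by (rule T.wait_moment_Suc[OF s(2)])
  qed
  moreover have "\<mu> 0 i = (if i = 0 then 1 else 0)" for i
    by (simp add: \<mu> T.wait_moment_0)
  moreover have "\<mu> 1 j = (\<Sum>k\<le>j. real (j choose k) * \<mu> 1 k *
            (1 - a * (real l ^ (j - k) - p ^ m2 * real (l + m2) ^ (j - k))))
          + q * a * (\<Sum>k=l+1..l+m2. real k ^ j * p ^ (k - l - 1))" for j
    unfolding \<mu> a assms(12) m2 by (rule T.wait_moment_1)
  ultimately show ?thesis
    by blast
qed

end
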